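(* Let $T$ be a power-bounded operator on a Banach space $X$ and let $x\in X$. Then the following are equivalent (convergence is in norm): (i) $\frac1n\sum_{k=1}^nT^{p_k}x$ converges as $n\to\infty$. (ii) $\frac1N\sum_{j=1}^{\pi(N)}(\log p_j)\,T^{p_j}x=\frac1N\sum_{k=1}^N\Lambda'(k)T^kx$ converges as $N\to\infty$. (iii) $\frac1N\sum_{k=1}^N\Lambda(k)T^kx$ converges as $N\to\infty$. If any one of these limits exists, then the three limits are the same.
   Context: $\mathbb P$ denotes the set of prime numbers, $p_1<p_2<\cdots$ is the increasing sequence of all primes, and $\pi(N)$ is the number of primes not exceeding $N$. The von Mangoldt function $\Lambda$ is defined by $\Lambda(n)=\log p$ if $n=p^k$ for some $p\in\mathbb P$ and some integer $k\ge1$, and $\Lambda(n)=0$ otherwise. The modified von Mangoldt function is $\Lambda'(n)=1_{\mathbb P}(n)\log n$. A bounded linear operator $T$ is power-bounded if $\sup_{n\ge0}\|T^n\|<\infty$. *)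

theory Defs
  imports "HOL-Analysis.Analysis" "HOL-Number_Theory.Prime_Powers" "HOL-Library.Infinite_Set"
begin

text \<open>
  The scalars are real. A complex Banach space is in particular a real one, and a bounded
  complex-linear operator is bounded and real-linear with the same operator norm, so
  complex Banach spaces are covered as well.
\<close>

definition power_bounded :: "('a::real_normed_vector \<Rightarrow> 'a) \<Rightarrow> bool" where
  "power_bounded T \<longleftrightarrow> bounded_linear T \<and> bdd_above (range (\<lambda>n::nat. onorm (T ^^ n)))"

text \<open>
  Primes are numbered from 1, so \<open>nth_prime 1 = 2\<close>, whereas \<^const>\<open>enumerate\<close> counts from 0.
  The value \<open>nth_prime 0\<close> is irrelevant.
\<close>
definition nth_prime :: "nat \<Rightarrow> nat" where
  "nth_prime k = enumerate {p. prime p} (k - 1)"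

lemma strict_mono_on_nth_prime: "strict_mono_on {1..} nth_prime"
  unfolding nth_prime_def
  by (intro strict_mono_onI enumerate_mono primes_infinite) auto

lemma nth_prime_image: "nth_prime ` {1..} = {p. prime p}"
proof -
  have "nth_prime ` {1..} = enumerate {p. prime p} ` ((\<lambda>k. k - 1) ` {1..})"
    by (simp add: nth_prime_def image_image)
  also have "(\<lambda>k. k - 1) ` {1..} = (UNIV :: nat set)"
    by (auto intro!: image_eqI[of _ _ "Suc x" for x])
  finally show ?thesis
    by (simp add: range_enumerate primes_infinite)
qed

definition prime_count :: "nat \<Rightarrow> nat" where
  "prime_count N = card {p. prime p \<and> p \<le> N}"

definition mangoldt' :: "nat \<Rightarrow> real" where
  "mangoldt' n = indicator {p. prime p} n * ln (real n)"

definition prime_average :: "('a::real_vector \<Rightarrow> 'a) \<Rightarrow> 'a \<Rightarrow> nat \<Rightarrow> 'a" where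
  "prime_average T x n = (1 / real n) *\<^sub>R (\<Sum>k=1..n. (T ^^ nth_prime k) x)"

definition log_prime_average :: "('a::real_vector \<Rightarrow> 'a) \<Rightarrow> 'a \<Rightarrow> nat \<Rightarrow> 'a" where
  "log_prime_average T x N =
     (1 / real N) *\<^sub>R (\<Sum>j=1..prime_count N. ln (real (nth_prime j)) *\<^sub>R (T ^^ nth_prime j) x)"

definition weighted_average :: "(nat \<Rightarrow> real) \<Rightarrow> ('a::real_vector \<Rightarrow> 'a) \<Rightarrow> 'a \<Rightarrow> nat \<Rightarrow> 'a" where
  "weighted_average w T x N = (1 / real N) *\<^sub>R (\<Sum>k=1..N. w k *\<^sub>R (T ^^ k) x)"

end

theory Submission
  imports Defs "HOL-Complex_Analysis.Complex_Analysis" "HOL-Real_Asymp.Real_Asymp"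
begin

text \<open>
  For \<open>T = id\<close> the equivalence of (i) and (ii) contains \<open>\<theta>(N) \<sim> N\<close>, so the prime number theorem is
  unavoidable. Conversely, it suffices: it gives \<open>\<Sum>\<^sub>p\<^sub>\<le>\<^sub>N log (N/p) = \<pi>(N) log N - \<theta>(N) = o(N)\<close>, so on a
  bounded orbit the weights \<open>log p\<close> may be replaced by \<open>log N\<close> at the cost of \<open>o(N)\<close> in norm, and
  \<open>\<pi>(N) log N \<sim> N\<close> matches the two normalisations. The proper prime powers contribute only \<open>o(N)\<close>.

  The prime number theorem is obtained from Newman's Tauberian theorem, applied to
  \<open>\<Sum> (\<psi>(n)/n - 1) n\<^sup>-\<^sup>s\<close>. The coefficients are bounded by Chebyshev's estimate, and the sum continues
  analytically across \<open>Re s = 1\<close> because \<open>\<zeta>\<close> has no zeros there. Convergence at \<open>s = 1\<close> forces \<open>\<psi>(n) \<sim> n\<close>.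
\<close>

section \<open>Newman's Tauberian theorem\<close>

text \<open>The Tauberian theorem needs bounded coefficients, and Lambda(n) - 1 is unbounded.
  Summation by parts trades it for psi(n)/n - 1, bounded as soon as psi(n) = O(n); the price is a
  factor 1/s and a correction series that converges for Re s > 0. Both -zeta'/zeta and zeta have a
  simple pole at 1 with residue 1, and subtracting exactly 1 from psi(n)/n makes these poles cancel.
  To keep poles out of the arguments, everything is expressed through the holomorphic function (s-1)
  zeta(s). Its continuation to Re s > 0 is enough, since the contour for the continued function
  leaves Re s >= 1 only by a small amount that may depend on R. Convergence of the sum of (psi(n) -
  n)/n^2 would not by itself force psi(n)/n to converge; the monotonicity of psi is what excludes
  rare large deviations. On the operator side, (i) is indexed by the number of primes while (ii) and
  (iii) are indexed by the bound N. Substituting n = pi(N) reconciles them, because pi takes every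
  value n >= 1.\<close>

lemma path_image_right_half_circle:
  assumes "0 < R"
  shows "path_image (part_circlepath 0 R (-pi/2) (pi/2)) \<subseteq> sphere 0 R \<inter> {z. 0 \<le> Re z}"
proof
  fix z assume "z \<in> path_image (part_circlepath 0 R (-pi/2) (pi/2))"
  then obtain t where t: "-pi/2 \<le> t" "t \<le> pi/2" "z = R * exp (\<i> * t)"
    using path_image_part_circlepath[of "-pi/2" "pi/2" 0 R] by auto
  have "0 \<le> cos t" using t by (intro cos_ge_zero) auto
  then show "z \<in> sphere 0 R \<inter> {z. 0 \<le> Re z}"
    using t assms by (auto simp: norm_mult Re_exp)
qed

lemma path_image_left_half_circle:
  assumes "0 < R"
  shows "path_image (part_circlepath 0 R (pi/2) (3*pi/2)) \<subseteq> sphere 0 R \<inter> {z. Re z \<le> 0}"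
proof
  fix z assume "z \<in> path_image (part_circlepath 0 R (pi/2) (3*pi/2))"
  then obtain t where t: "pi/2 \<le> t" "t \<le> 3*pi/2" "z = R * exp (\<i> * t)"
    using path_image_part_circlepath[of "pi/2" "3*pi/2" 0 R] by auto
  have "0 \<le> cos (t - pi)" using t by (intro cos_ge_zero) auto
  then have "cos t \<le> 0" by (simp add: cos_diff)
  then show "z \<in> sphere 0 R \<inter> {z. Re z \<le> 0}"
    using t assms by (auto simp: norm_mult Re_exp mult_nonneg_nonpos)
qed

lemma exp_half_circle_ends:
  "exp (\<i> * complex_of_real (-pi/2)) = -\<i>" "exp (\<i> * complex_of_real (pi/2)) = \<i>"
  "exp (\<i> * complex_of_real (3*pi/2)) = -\<i>"
proof -
  have "cos (3*pi/2) = 0" "sin (3*pi/2) = -1"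
    using cos_3over2_pi sin_3over2_pi by (simp_all add: field_simps)
  then show "exp (\<i> * complex_of_real (-pi/2)) = -\<i>" "exp (\<i> * complex_of_real (pi/2)) = \<i>"
    "exp (\<i> * complex_of_real (3*pi/2)) = -\<i>"
    by (auto simp: complex_eq_iff Re_exp Im_exp)
qed

lemma Ln_imaginary: "0 < R \<Longrightarrow> Ln (\<i> * complex_of_real R) = Ln (complex_of_real R) + \<i>*pi/2"
   "0 < R \<Longrightarrow> Ln (-(\<i> * complex_of_real R)) = Ln (complex_of_real R) - \<i>*pi/2"
  using Ln_times_of_real[of R \<i>] Ln_times_of_real[of R "-\<i>"]
  by (simp_all add: Ln_of_real mult.commute)

text \<open>Newman's kernel \<open>1/z + z/R\<^sup>2\<close> turns the Cauchy formula into one whose kernel is small near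
  \<open>\<plusminus>\<i>R\<close>; computing the winding number by primitives leaves the choice of the left part free.\<close>

lemma Cauchy_half_circle:
  assumes "open S" "convex S" "h holomorphic_on S" and R: "0 < R"
    and rS: "path_image (part_circlepath 0 R (-pi/2) (pi/2)) \<subseteq> S"
    and P: "valid_path P" "pathstart P = \<i> * R" "pathfinish P = -(\<i> * R)"
      "path_image P \<subseteq> S - \<real>\<^sub>\<ge>\<^sub>0"
  defines "g \<equiv> (\<lambda>z. h z * (1/z + z/R\<^sup>2))"
  shows "contour_integral (part_circlepath 0 R (-pi/2) (pi/2)) g + contour_integral P g = 2*pi*\<i> * h 0"
proof -
  define Q where "Q = part_circlepath 0 R (-pi/2) (pi/2)"
  have Qends: "pathstart Q = -(\<i> * R)" "pathfinish Q = \<i> * R"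
    using exp_half_circle_ends by (simp_all add: Q_def)
  \<comment> \<open>Since 1/z + z/R^2 = (1 + z^2/R^2)/z, one has \<open>g z = k z / z\<close> and
    \<open>k 0 = h 0\<close>.\<close>
  define k where "k = (\<lambda>z. h z * (1 + z\<^sup>2/R\<^sup>2))"
  have hk: "k holomorphic_on S"
    unfolding k_def using assms by (auto intro!: holomorphic_intros)
  \<comment> \<open>Removing the singularity splits \<open>g\<close> into \<open>q\<close>, to which
    Cauchy's theorem applies on the closed path, and \<open>h 0\<close> times 1/z.\<close>
  define q where "q = (\<lambda>z. if z = 0 then deriv k 0 else (k z - k 0)/(z - 0))"
  have hq: "q holomorphic_on S"
    unfolding q_def by (rule pole_lemma_open[OF hk \<open>open S\<close>])
  have vQ: "valid_path Q" by (simp add: Q_def)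
  have int0: "(q has_contour_integral 0) (Q +++ P)"
    using P rS[folded Q_def] Qends vQ
    by (intro Cauchy_theorem_convex_simple[OF hq \<open>convex S\<close>])
       (auto simp: path_image_join Q_def[symmetric])
  have iq: "q contour_integrable_on Q" "q contour_integrable_on P"
    using contour_integrable_holomorphic_simple[OF hq \<open>open S\<close>] vQ P rS by (auto simp: Q_def)
  have sum0: "contour_integral Q q + contour_integral P q = 0"
    using int0 contour_integral_join[OF iq vQ P(1)] contour_integral_unique by metis
  have L: "Ln (\<i> * R) = Ln R + \<i>*pi/2" "Ln (-(\<i> * R)) = Ln R - \<i>*pi/2"
    using Ln_imaginary[OF R] by auto
  \<comment> \<open>The right half circle avoids the cut of \<open>Ln\<close>; the path
    \<open>P\<close> below avoids the nonnegative axis, the cut of Ln(-z). Each half contributes i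
    pi.\<close>
  have "((\<lambda>z. 1/z) has_contour_integral (Ln (pathfinish Q) - Ln (pathstart Q))) Q"
  proof (rule contour_integral_primitive[where S = "-\<real>\<^sub>\<le>\<^sub>0"])
    show "path_image Q \<subseteq> - \<real>\<^sub>\<le>\<^sub>0"
    proof
      fix z assume "z \<in> path_image Q"
      then have z: "norm z = R" "0 \<le> Re z"
        using path_image_right_half_circle[OF R] by (auto simp: Q_def)
      show "z \<in> - \<real>\<^sub>\<le>\<^sub>0"
      proof
        assume "z \<in> \<real>\<^sub>\<le>\<^sub>0"
        then have "Re z \<le> 0" "Im z = 0" by (auto simp: complex_nonpos_Reals_iff)
        with z have "z = 0" by (simp add: complex_eq_iff)
        with z R show False by simp
      qed
    qed
  qed (use vQ in \<open>simp_all add: has_field_derivative_Ln has_field_derivative_at_within divide_inverse\<close>)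
  then have i1: "((\<lambda>z. 1/z) has_contour_integral (\<i>*pi)) Q"
    using L Qends by (simp add: algebra_simps)
  have "((\<lambda>z. 1/z) has_contour_integral (Ln (-pathfinish P) - Ln (-pathstart P))) P"
  proof (rule contour_integral_primitive[where S = "-\<real>\<^sub>\<ge>\<^sub>0" and f = "\<lambda>z. Ln (-z)"])
    fix x :: complex assume x: "x \<in> - \<real>\<^sub>\<ge>\<^sub>0"
    then have "-x \<notin> \<real>\<^sub>\<le>\<^sub>0" "x \<noteq> 0" by (auto simp: complex_nonpos_Reals_iff complex_nonneg_Reals_iff)
    then show "((\<lambda>z. Ln (-z)) has_field_derivative 1/x) (at x within - \<real>\<^sub>\<ge>\<^sub>0)"
      by (auto intro!: derivative_eq_intros simp: field_simps)
  qed (use P in auto)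
  then have i2: "((\<lambda>z. 1/z) has_contour_integral (\<i>*pi)) P"
    using L P by (simp add: algebra_simps)
  have nz: "z \<noteq> 0" if "z \<in> path_image Q \<or> z \<in> path_image P" for z
    using that P(4) path_image_right_half_circle[OF R] R by (auto simp: Q_def)
  have eq: "g z = q z + h 0 * (1/z)" if "z \<in> path_image Q \<or> z \<in> path_image P" for z
    using nz[OF that] by (simp add: g_def q_def k_def field_simps power2_eq_square)
  have "(g has_contour_integral (contour_integral Q q + h 0 * (\<i>*pi))) Q"
    by (rule has_contour_integral_eq[OF has_contour_integral_add[OF
          has_contour_integral_integral[OF iq(1)] has_contour_integral_lmul[OF i1]]])
       (use eq in auto)
  moreover have "(g has_contour_integral (contour_integral P q + h 0 * (\<i>*pi))) P"
    by (rule has_contour_integral_eq[OF has_contour_integral_add[OF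
          has_contour_integral_integral[OF iq(2)] has_contour_integral_lmul[OF i2]]])
       (use eq in auto)
  ultimately have "contour_integral Q g + contour_integral P g
      = contour_integral Q q + contour_integral P q + 2*pi*\<i> * h 0"
    by (simp add: contour_integral_unique)
  then show ?thesis using sum0 by (simp add: Q_def)
qed

section \<open>Estimates for the integrands on the contour\<close>

lemma norm_of_nat_powr: "norm (of_nat n powr z :: complex) = real n powr Re z"
  by (subst norm_powr_real_powr) auto

text \<open>At parameter x the factor N^z has modulus N^(x Re q), at most 1 and tending to 0 for
  every x > 0. Dominated convergence therefore tolerates the end \<open>p\<close> on the imaginary
  axis, where there is no decay.\<close>

lemma contour_integral_linepath_powr_tendsto_0:
  assumes c: "continuous_on (closed_segment p q) h" and p: "Re p = 0" and q: "Re q < 0"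
  shows "(\<lambda>N. contour_integral (linepath p q) (\<lambda>z. h z * of_nat N powr z)) \<longlonglongrightarrow> 0"
proof -
  have cont: "continuous_on (closed_segment p q) (\<lambda>z. h z * of_nat (Suc N) powr z)" for N
  proof -
    have "continuous_on A (\<lambda>z. of_nat (Suc N) powr z)" for A :: "complex set"
      by (intro holomorphic_on_imp_continuous_on holomorphic_intros)
    then show ?thesis using c by (intro continuous_on_mult)
  qed
  \<comment> \<open>The value 0 at x = 0 gives pointwise convergence everywhere without changing the
    integral; \<open>Suc N\<close> keeps the base positive.\<close>
  define F where "F = (\<lambda>N x. if x = 0 then 0
      else h (linepath p q x) * of_nat (Suc N) powr (linepath p q x) * (q - p))"
  have F_int: "(F N has_integral contour_integral (linepath p q) (\<lambda>z. h z * of_nat (Suc N) powr z)) {0..1}" for N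
  proof (rule has_integral_spike_finite[where S = "{0}"])
    show "((\<lambda>x. h (linepath p q x) * of_nat (Suc N) powr (linepath p q x) * (q - p)) has_integral
        contour_integral (linepath p q) (\<lambda>z. h z * of_nat (Suc N) powr z)) {0..1}"
      using has_contour_integral_integral[OF contour_integrable_continuous_linepath[OF cont[of N]]]
      by (simp add: has_contour_integral_linepath)
  qed (auto simp: F_def)
  have "compact (h ` closed_segment p q)"
    by (intro compact_continuous_image c) auto
  then obtain B where B: "\<And>z. z \<in> closed_segment p q \<Longrightarrow> norm (h z) \<le> B"
    by (metis bounded_iff compact_imp_bounded imageI)
  have B0: "0 \<le> B" using order_trans[OF norm_ge_zero B[of p]] by simp
  have Fn: "norm (F N x) \<le> B * real (Suc N) powr (x * Re q) * norm (q - p)" if "x \<in> {0..1}" for N x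
  proof -
    have "linepath p q x \<in> closed_segment p q"
      using that by (auto simp: closed_segment_def linepath_def)
    moreover have "norm (of_nat (Suc N) powr linepath p q x) = real (Suc N) powr (x * Re q)"
      unfolding norm_of_nat_powr using p by (simp add: linepath_def)
    ultimately show ?thesis
      using B B0 unfolding F_def by (auto simp: norm_mult intro!: mult_mono simp del: of_nat_Suc)
  qed
  have "(\<lambda>k. integral {0..1} (F k)) \<longlonglongrightarrow> integral {0..1} (\<lambda>_::real. 0::complex)"
  proof (rule dominated_convergence(2)[where h = "\<lambda>_. B * norm (q - p)"])
    show "F k integrable_on {0..1}" for k using F_int by blast
    show "norm (F k x) \<le> B * norm (q - p)" if "x \<in> {0..1}" for k x
    proof -
      have "real (Suc k) powr (x * Re q) \<le> real (Suc k) powr 0"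
        using that q by (intro powr_mono) (auto simp: mult_nonneg_nonpos)
      then have "real (Suc k) powr (x * Re q) \<le> 1" by simp
      then have "B * real (Suc k) powr (x * Re q) * norm (q - p) \<le> B * 1 * norm (q - p)"
        by (intro mult_mono) (use B0 in auto)
      with Fn[OF that, of k] show ?thesis by simp
    qed
    show "(\<lambda>k. F k x) \<longlonglongrightarrow> 0" if "x \<in> {0..1}" for x
    proof (cases "x = 0")
      case True
      then show ?thesis by (simp add: F_def)
    next
      case False
      with that q have neg: "x * Re q < 0" by (simp add: mult_pos_neg)
      have "(\<lambda>k. real (Suc k) powr (x * Re q)) \<longlonglongrightarrow> 0"
        by (rule tendsto_neg_powr[OF neg]) (rule filterlim_compose[OF filterlim_real_sequentially filterlim_Suc])
      then have "(\<lambda>k. B * real (Suc k) powr (x * Re q) * norm (q - p)) \<longlonglongrightarrow> B * 0 * norm (q - p)"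
        by (intro tendsto_intros)
      then show ?thesis
        using False Fn[OF that] by (intro Lim_null_comparison[of "\<lambda>k. F k x"]) (auto)
    qed
  qed auto
  then have "(\<lambda>N. contour_integral (linepath p q) (\<lambda>z. h z * of_nat (Suc N) powr z)) \<longlonglongrightarrow> 0"
    unfolding integral_unique[OF F_int] by simp
  then show ?thesis by (rule LIMSEQ_imp_Suc)
qed

lemma powr_increment:
  fixes n :: nat and p :: real
  assumes "0 < n"
  obtains z where "real n < z" "z < real (Suc n)" "real (Suc n) powr p - real n powr p = p * z powr (p - 1)"
proof -
  have "\<exists>z>real n. z < real (Suc n) \<and> real (Suc n) powr p - real n powr p = (real (Suc n) - real n) * (p * z powr (p - 1))"
    using assms by (intro MVT2) (auto intro!: derivative_eq_intros)
  then show ?thesis using that by auto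
qed

text \<open>Comparison with the integral of t^(-1-x), carried out by the mean value theorem and
  telescoping.\<close>

lemma sum_powr_tail_le:
  fixes x :: real
  assumes "0 < x" "0 < N"
  shows "(\<Sum>n=N..<M. real (Suc n) powr (-1-x)) \<le> real N powr -x / x"
proof (cases "N \<le> M")
  case True
  have "(\<Sum>n=N..<M. real (Suc n) powr (-1-x)) \<le> (\<Sum>n=N..<M. (real (Suc n) powr -x - real n powr -x) / -x)"
  proof (rule sum_mono)
    fix n assume "n \<in> {N..<M}"
    then have "0 < n" using assms by auto
    then obtain z where z: "real n < z" "z < real (Suc n)"
      "real (Suc n) powr -x - real n powr -x = -x * z powr (-x - 1)"
      using powr_increment by metis
    have "-1 - x = -x - 1" by simp
    have "real (Suc n) powr (-x-1) \<le> z powr (-x-1)"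
      using z assms by (intro powr_mono2') auto
    then show "real (Suc n) powr (-1-x) \<le> (real (Suc n) powr -x - real n powr -x) / -x"
      unfolding z(3) \<open>-1 - x = -x - 1\<close> using assms by simp
  qed
  also have "\<dots> = (real M powr -x - real N powr -x) / -x"
    unfolding sum_divide_distrib[symmetric] by (subst sum_Suc_diff'[OF True]) simp
  also have "\<dots> \<le> real N powr -x / x"
    using assms by (simp add: field_simps)
  finally show ?thesis .
qed (use assms in auto)

text \<open>For y <= 1 the function t^(y-1) decreases and each term is at most the integral over the
  unit interval to its left. For y > 1 it increases and the interval to the right must be used, so
  the last term N^(y-1) = N^y / N is split off: this is the origin of 1/N.\<close>

lemma sum_powr_head_le:
  fixes y :: real
  assumes "0 < y" "0 < N"
  shows "(\<Sum>n<N. real (Suc n) powr (y-1)) \<le> real N powr y * (1/y + 1/N)"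
proof (cases "y \<le> 1")
  case True
  have "(\<Sum>n<N. real (Suc n) powr (y-1)) \<le> (\<Sum>n<N. (real (Suc n) powr y - real n powr y) / y)"
  proof (rule sum_mono)
    fix n
    show "real (Suc n) powr (y-1) \<le> (real (Suc n) powr y - real n powr y) / y"
    proof (cases "n = 0")
      case True
      then show ?thesis using assms \<open>y \<le> 1\<close> by (simp add: field_simps)
    next
      case False
      then obtain z where z: "real n < z" "z < real (Suc n)"
        "real (Suc n) powr y - real n powr y = y * z powr (y - 1)"
        using powr_increment by (metis gr0I)
      have "real (Suc n) powr (y-1) \<le> z powr (y-1)"
        using z True by (intro powr_mono2') auto
      then show ?thesis unfolding z(3) using assms by simp
    qed
  qed
  also have "\<dots> = real N powr y / y"
    unfolding sum_divide_distrib[symmetric] by (subst sum_lessThan_telescope) simp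
  finally show ?thesis using assms by (simp add: algebra_simps add_increasing2)
next
  case False
  obtain M where M: "N = Suc M" using assms by (cases N) auto
  have "(\<Sum>n<M. real (Suc n) powr (y-1)) \<le> (\<Sum>n<M. (real (Suc (Suc n)) powr y - real (Suc n) powr y) / y)"
  proof (rule sum_mono)
    fix n
    obtain z where z: "real (Suc n) < z"
        "real (Suc (Suc n)) powr y - real (Suc n) powr y = y * z powr (y - 1)"
      using powr_increment[of "Suc n" y] by blast
    have "real (Suc n) powr (y-1) \<le> z powr (y-1)"
      using z False by (intro powr_mono2) auto
    then show "real (Suc n) powr (y-1) \<le> (real (Suc (Suc n)) powr y - real (Suc n) powr y) / y"
      unfolding z(2) using assms by simp
  qed
  also have "\<dots> = (real N powr y - 1) / y"
    unfolding sum_divide_distrib[symmetric] M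
    using sum_lessThan_telescope[of "\<lambda>n. real (Suc n) powr y" M] by simp
  also have "\<dots> \<le> real N powr y / y" using assms by (simp add: field_simps)
  finally have "(\<Sum>n<N. real (Suc n) powr (y-1)) \<le> real N powr y / y + real N powr (y-1)"
    unfolding M by simp
  also have "real N powr (y-1) = real N powr y / N"
    using assms by (simp add: powr_diff)
  finally show ?thesis by (simp add: algebra_simps)
qed

text \<open>On the circle 1/z = cnj z / R^2, so the kernel is the real number 2 Re z / R^2. The
  factor Re z cancels the 1/x and 1/y of the power sum bounds.\<close>

lemma norm_Newman_kernel:
  assumes "norm z = R" "0 < R"
  shows "norm (1/z + z/(complex_of_real (R\<^sup>2))) = 2 * \<bar>Re z\<bar> / R\<^sup>2"
proof -
  have "z * cnj z = of_real (R\<^sup>2)"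
    using assms by (simp add: complex_norm_square[symmetric])
  then have "1/z = cnj z / of_real (R\<^sup>2)"
    using assms by (auto simp: field_simps)
  then have "1/z + z/(of_real (R\<^sup>2)) = of_real (2 * Re z) / of_real (R\<^sup>2)"
    by (simp add: add_divide_distrib[symmetric] complex_add_cnj add.commute)
  then show ?thesis using assms by (simp add: norm_divide norm_mult norm_power)
qed

text \<open>On the right half circle, f - S_N is at most C N^-x / x, and the factors N^x and 2x/R^2
  reduce this to 2C/R^2 uniformly in N. The partial sum S_N is entire, so its left contour may be
  the left half circle, where the same cancellation gives 4C/R^2. The function f is continued only
  slightly to the left, so its left contour hugs the imaginary axis, and its contribution
  \<open>E N\<close> vanishes as N grows with R fixed. Dividing by 2 pi leaves 3C/R.\<close>

theorem Newman_tauberian: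
  fixes a :: "nat \<Rightarrow> complex"
  assumes a: "\<And>n. norm (a n) \<le> C" and U: "open U" "{s. 1 \<le> Re s} \<subseteq> U"
    and f: "f holomorphic_on U"
    and sums: "\<And>s. 1 < Re s \<Longrightarrow> (\<lambda>n. a n * of_nat (Suc n) powr -s) sums f s"
  shows "(\<lambda>n. a n / of_nat (Suc n)) sums f 1"
proof -
  define S where "S = (\<lambda>N z. \<Sum>n<N. a n * of_nat (Suc n) powr -(1+z))"
  have holS: "S N holomorphic_on A" for N A
    unfolding S_def by (intro holomorphic_intros)
  have S0: "S N 0 = (\<Sum>n<N. a n / of_nat (Suc n))" for N
    by (simp add: S_def powr_minus divide_inverse del: of_nat_Suc)
  have C0: "0 \<le> C" using a[of 0] norm_ge_zero order_trans by blast
  have nt: "norm (a n * of_nat (Suc n) powr -(1+z)) \<le> C * real (Suc n) powr (-1 - Re z)" for n z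
    unfolding norm_mult norm_of_nat_powr by (intro mult_mono) (use a C0 in auto)
  have tail: "norm (f (1+z) - S N z) \<le> C * (real N powr -x / x)"
    if "Re z = x" "0 < x" "0 < N" for z N x
  proof (rule Lim_norm_ubound)
    have "(\<lambda>M. S M z) \<longlonglongrightarrow> f (1+z)"
      using sums[of "1+z"] that by (simp add: S_def sums_def)
    then show "(\<lambda>M. S M z - S N z) \<longlonglongrightarrow> f (1+z) - S N z" by (intro tendsto_intros)
    show "\<forall>\<^sub>F M in sequentially. norm (S M z - S N z) \<le> C * (real N powr -x / x)"
      using eventually_ge_at_top[of N]
    proof eventually_elim
      case (elim M)
      have "S M z - S N z = (\<Sum>n=N..<M. a n * of_nat (Suc n) powr -(1+z))"
        unfolding S_def using elim by (simp add: sum_diff_nat_ivl flip: atLeast0LessThan)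
      also have "norm \<dots> \<le> (\<Sum>n=N..<M. C * real (Suc n) powr (-1 - x))"
        using nt that by (intro sum_norm_le) auto
      also have "\<dots> \<le> C * (real N powr -x / x)"
        unfolding sum_distrib_left[symmetric] using that C0 sum_powr_tail_le[of x N M]
        by (intro mult_left_mono) auto
      finally show ?case .
    qed
  qed simp
  have head: "norm (S N z) \<le> C * (real N powr y * (1/y + 1/N))" if "Re z = -y" "0 < y" "0 < N" for z N y
  proof -
    have "norm (S N z) \<le> (\<Sum>n<N. C * real (Suc n) powr (y - 1))"
      unfolding S_def using nt[of _ z] that by (intro sum_norm_le) (auto simp: algebra_simps)
    also have "\<dots> \<le> C * (real N powr y * (1/y + 1/N))"
      unfolding sum_distrib_left[symmetric] using that C0 sum_powr_head_le[of y N]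
      by (intro mult_left_mono) auto
    finally show ?thesis .
  qed
  have main: "\<forall>\<^sub>F N in sequentially. dist (S N 0) (f 1) < e" if e: "0 < e" for e
  proof -
    \<comment> \<open>Chosen so that 3C/R < e/2; the summand 1 covers C = 0.\<close>
    define R where "R = (6*C+1)/e"
    have R: "0 < R" using e C0 by (simp add: R_def)
    have RC: "3*C/R < e/2" using e C0 by (simp add: R_def field_simps)
    define K where "K = (\<lambda>z. 1/z + z/(complex_of_real (R\<^sup>2)))"
    define Q where "Q = part_circlepath 0 R (-pi/2) (pi/2)"
    define L where "L = part_circlepath 0 R (pi/2) (3*pi/2)"
    have Qi: "norm z = R \<and> 0 \<le> Re z" if "z \<in> path_image Q" for z
      using path_image_right_half_circle[OF R] that by (auto simp: Q_def)
    have Li: "norm z = R \<and> Re z \<le> 0" if "z \<in> path_image L" for z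
      using path_image_left_half_circle[OF R] that by (auto simp: L_def)
    have Kbd: "norm (K z) = 2 * \<bar>Re z\<bar> / R\<^sup>2" if "norm z = R" for z
      unfolding K_def using norm_Newman_kernel[OF that R] .
    \<comment> \<open>Compactness gives one width \<delta> by which the continuation extends to the
      left along the whole segment. The height 2R leaves room around the ends of the half
      circle.\<close>
    have "compact (closed_segment (1 - 2*R*\<i>) (1 + 2*R*\<i>))" by simp
    moreover have segU: "closed_segment (1 - 2*R*\<i>) (1 + 2*R*\<i>) \<subseteq> U"
    proof -
      have "Re z = 1" if "z \<in> closed_segment (1 - 2*R*\<i>) (1 + 2*R*\<i>)" for z
        using that unfolding closed_segment_def by auto
      then show ?thesis using U(2) by auto
    qed
    ultimately obtain \<delta> where \<delta>: "0 < \<delta>"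
      "(\<Union>x\<in>closed_segment (1 - 2*R*\<i>) (1 + 2*R*\<i>). ball x \<delta>) \<subseteq> U"
      using compact_subset_open_imp_ball_epsilon_subset U(1) by metis
    define D where "D = {z. -\<delta> < Re z \<and> -2*R < Im z \<and> Im z < 2*R}"
    have "D = {z. Re z > -\<delta>} \<inter> {z. Im z > -2*R} \<inter> {z. Im z < 2*R}"
      by (auto simp: D_def)
    then have D: "open D" "convex D"
      by (auto intro!: open_Int convex_Int open_halfspace_Re_gt open_halfspace_Im_gt open_halfspace_Im_lt
          convex_halfspace_Re_gt convex_halfspace_Im_gt convex_halfspace_Im_lt)
    have DU: "1 + z \<in> U" if "z \<in> D" for z
    proof (cases "0 \<le> Re z")
      case True then show ?thesis using U(2) by auto
    next
      case False
      \<comment> \<open>The point of the segment at the height of z; only the real parts differ, by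
        less than \<delta>.\<close>
      have "1 + \<i> * Im z \<in> closed_segment (1 - 2*R*\<i>) (1 + 2*R*\<i>)"
        unfolding closed_segment_def using that R
        by (auto intro!: exI[of _ "(Im z + 2*R)/(4*R)"] simp: D_def complex_eq_iff field_simps)
      moreover have "dist (1 + \<i> * Im z) (1 + z) < \<delta>"
        using that False by (simp add: dist_norm D_def cmod_def)
      ultimately have "1 + z \<in> (\<Union>x\<in>closed_segment (1 - 2*R*\<i>) (1 + 2*R*\<i>). ball x \<delta>)"
        unfolding UN_iff mem_ball by blast
      then show ?thesis using \<delta>(2) by blast
    qed
    define d where "d = \<delta>/2"
    have d: "0 < d" "d < \<delta>" using \<delta> by (auto simp: d_def)
    define V1 where "V1 = closed_segment (\<i>*R) (-complex_of_real d)"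
    define V2 where "V2 = closed_segment (-(\<i>*R)) (-complex_of_real d)"
    \<comment> \<open>A wedge through -d: each leg touches the imaginary axis only at one end, and
      the origin lies to the right of the wedge.\<close>
    define V where "V = linepath (\<i>*R) (-complex_of_real d) +++ linepath (-complex_of_real d) (-(\<i>*R))"
    have VD: "V1 \<subseteq> D - \<real>\<^sub>\<ge>\<^sub>0" "V2 \<subseteq> D - \<real>\<^sub>\<ge>\<^sub>0"
    proof -
      have "\<i>*R \<in> D" "-(\<i>*R) \<in> D" "-complex_of_real d \<in> D" using d R \<delta> by (auto simp: D_def)
      then have "V1 \<subseteq> D" "V2 \<subseteq> D" unfolding V1_def V2_def using D by (simp_all add: closed_segment_subset)
      moreover have "z \<notin> \<real>\<^sub>\<ge>\<^sub>0" if "z \<in> V1 \<union> V2" for z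
        using that d R by (auto simp: V1_def V2_def closed_segment_def complex_nonneg_Reals_iff)
      ultimately show "V1 \<subseteq> D - \<real>\<^sub>\<ge>\<^sub>0" "V2 \<subseteq> D - \<real>\<^sub>\<ge>\<^sub>0" by auto
    qed
    have V: "valid_path V" "pathstart V = \<i> * R" "pathfinish V = -(\<i> * R)" "path_image V \<subseteq> D - \<real>\<^sub>\<ge>\<^sub>0"
      using VD closed_segment_commute[of "-(\<i>*R)" "-complex_of_real d"]
      by (auto simp: V_def V1_def V2_def path_image_join)
    have Lends: "valid_path L" "pathstart L = \<i> * R" "pathfinish L = -(\<i> * R)"
      using exp_half_circle_ends unfolding L_def by (simp_all add: mult.commute)
    have LR: "path_image L \<subseteq> UNIV - \<real>\<^sub>\<ge>\<^sub>0"
    proof (intro subsetI DiffI notI)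
      fix z assume z: "z \<in> path_image L" "z \<in> \<real>\<^sub>\<ge>\<^sub>0"
      then have "z = 0" using Li[OF z(1)] by (simp add: complex_nonneg_Reals_iff complex_eq_iff)
      then show False using Li[OF z(1)] R by simp
    qed auto
    have QD: "path_image Q \<subseteq> D"
    proof
      fix z assume z: "z \<in> path_image Q"
      have "\<bar>Im z\<bar> < 2 * R" "0 \<le> Re z" using Qi[OF z] abs_Im_le_cmod[of z] R by auto
      then show "z \<in> D" using \<delta>(1) by (auto simp: D_def)
    qed
    have holf: "(\<lambda>z. f (1+z)) holomorphic_on D"
    proof (rule holomorphic_on_compose_gen[OF _ f, of "\<lambda>z. 1+z" D, unfolded o_def])
      show "(\<lambda>z. 1+z) holomorphic_on D" by (intro holomorphic_intros)
    qed (use DU in auto)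
    have Kcont: "continuous_on A K" if "0 \<notin> A" for A
      unfolding K_def using that R by (auto intro!: continuous_intros)
    define E where "E = (\<lambda>N. contour_integral V (\<lambda>z. f (1+z) * of_nat N powr z * K z))"
    have E0: "E \<longlonglongrightarrow> 0"
    proof -
      have cont: "continuous_on A (\<lambda>z. f (1+z) * K z)" if "A \<subseteq> D - \<real>\<^sub>\<ge>\<^sub>0" for A
      proof (rule continuous_on_mult)
        show "continuous_on A (\<lambda>z. f (1+z))"
          using that by (intro continuous_on_subset[OF holomorphic_on_imp_continuous_on[OF holf]]) auto
        show "continuous_on A K" using that by (intro Kcont) auto
      qed
      have "continuous_on A (\<lambda>z. of_nat N powr z :: complex)" for A N
        by (intro holomorphic_on_imp_continuous_on holomorphic_intros)
      then have contN: "continuous_on A (\<lambda>z. f (1+z) * K z * of_nat N powr z)" if "A \<subseteq> D - \<real>\<^sub>\<ge>\<^sub>0" for A N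
        by (rule continuous_on_mult[OF cont[OF that]])
      \<comment> \<open>The second leg is reversed so that both segments start on the imaginary
        axis, as the limit lemma requires.\<close>
      have EN: "E N = contour_integral (linepath (\<i>*R) (-complex_of_real d)) (\<lambda>z. f (1+z) * K z * of_nat N powr z)
           - contour_integral (linepath (-(\<i>*R)) (-complex_of_real d)) (\<lambda>z. f (1+z) * K z * of_nat N powr z)" for N
      proof -
        note cs = contN[OF VD(1), of N, unfolded V1_def] contN[OF VD(2), of N, unfolded V2_def]
        have "E N = contour_integral V (\<lambda>z. f (1+z) * K z * of_nat N powr z)"
          by (simp add: E_def mult_ac)
        then show ?thesis
          unfolding V_def using cs contour_integral_reverse_linepath[OF cs(2)]
          by (simp add: contour_integrable_continuous_linepath closed_segment_commute)
      qed
      have "E \<longlonglongrightarrow> 0 - 0"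
        unfolding EN[abs_def] using d
        by (intro tendsto_diff contour_integral_linepath_powr_tendsto_0 cont VD[unfolded V1_def V2_def]) auto
      then show ?thesis by simp
    qed
    have bound: "norm (f 1 - S N 0) \<le> 3*C/R + norm (E N)" if N: "0 < N" "R \<le> real N" for N
    proof -
      define p where "p = (\<lambda>z. of_nat N powr z :: complex)"
      have p: "p holomorphic_on A" for A unfolding p_def by (intro holomorphic_intros)
      have p0: "p 0 = 1" using N by (simp add: p_def)
      have "0 \<notin> path_image Q" "0 \<notin> path_image L" using Qi Li R by force+
      then have cK: "continuous_on (path_image Q) K" "continuous_on (path_image L) K" using Kcont by auto
      note cQ = contour_integrable_continuous_part_circlepath[of 0 R "-pi/2" "pi/2", folded Q_def]
      note cL = contour_integrable_continuous_part_circlepath[of 0 R "pi/2" "3*pi/2", folded L_def]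
      have iQf: "(\<lambda>z. f (1+z) * p z * K z) contour_integrable_on Q"
      proof (rule cQ)
        show "continuous_on (path_image Q) (\<lambda>z. f (1+z) * p z * K z)"
          using cK(1) continuous_on_subset[OF holomorphic_on_imp_continuous_on[OF holf] QD]
            holomorphic_on_imp_continuous_on[OF p]
          by (intro continuous_on_mult)
      qed
      have iQS: "(\<lambda>z. S N z * p z * K z) contour_integrable_on Q"
        using cK(1) holomorphic_on_imp_continuous_on[OF holS] holomorphic_on_imp_continuous_on[OF p]
        by (intro cQ continuous_on_mult)
      have iLS: "(\<lambda>z. S N z * p z * K z) contour_integrable_on L"
        using cK(2) holomorphic_on_imp_continuous_on[OF holS] holomorphic_on_imp_continuous_on[OF p]
        by (intro cL continuous_on_mult)
      \<comment> \<open>The same kernel and right arc serve f and S_N; only the left paths differ,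
        the wedge for f and the half circle for S_N.\<close>
      have c1: "contour_integral Q (\<lambda>z. f (1+z) * p z * K z) + E N = 2*pi*\<i> * f 1"
        using Cauchy_half_circle[OF D holomorphic_on_mult[OF holf p] R QD[unfolded Q_def] V] p0
        by (simp add: K_def Q_def E_def p_def)
      have c2: "contour_integral Q (\<lambda>z. S N z * p z * K z) + contour_integral L (\<lambda>z. S N z * p z * K z) = 2*pi*\<i> * S N 0"
        using Cauchy_half_circle[OF open_UNIV convex_UNIV holomorphic_on_mult[OF holS p] R _ Lends LR] p0
        by (simp add: K_def Q_def)
      have c3: "contour_integral Q (\<lambda>z. f (1+z) * p z * K z) - contour_integral Q (\<lambda>z. S N z * p z * K z)
          = contour_integral Q (\<lambda>z. (f (1+z) - S N z) * p z * K z)"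
        unfolding left_diff_distrib using iQf iQS by (subst contour_integral_diff) auto
      have eq: "2*pi*\<i> * (f 1 - S N 0) = contour_integral Q (\<lambda>z. (f (1+z) - S N z) * p z * K z)
          + E N - contour_integral L (\<lambda>z. S N z * p z * K z)"
        unfolding c3[symmetric] right_diff_distrib c1[symmetric] c2[symmetric] by simp
      have np: "norm (p z) = real N powr Re z" for z by (simp add: p_def norm_of_nat_powr)
      have I1: "norm (contour_integral Q (\<lambda>z. (f (1+z) - S N z) * p z * K z)) \<le> 2*C/R\<^sup>2 * R * \<bar>pi/2 - (-pi/2)\<bar>"
        unfolding Q_def
      proof (rule contour_integral_bound_part_circlepath)
        fix z assume "z \<in> path_image (part_circlepath 0 R (-pi/2) (pi/2))"
        then have z: "norm z = R" "0 \<le> Re z" using Qi Q_def by auto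
        show "norm ((f (1+z) - S N z) * p z * K z) \<le> 2*C/R\<^sup>2"
        \<comment> \<open>The tail bound degenerates on the imaginary axis, but the kernel vanishes
          there.\<close>
        proof (cases "Re z = 0")
          case True then show ?thesis using Kbd[OF z(1)] C0 by (simp add: norm_mult)
        next
          case False
          then have x: "0 < Re z" using z by simp
          have "norm ((f (1+z) - S N z) * p z * K z) \<le> C * (real N powr -Re z / Re z) * real N powr Re z * (2 * \<bar>Re z\<bar> / R\<^sup>2)"
            unfolding norm_mult np Kbd[OF z(1)] using tail[OF refl x N(1)] by (intro mult_right_mono) auto
          also have "\<dots> = C * (real N powr -Re z * real N powr Re z) * 2 / R\<^sup>2"
            using x by (simp add: field_simps)
          also have "real N powr -Re z * real N powr Re z = 1" using N by (simp flip: powr_add)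
          finally show ?thesis by (simp add: mult.commute)
        qed
      qed (use C0 R contour_integrable_diff[OF iQf iQS] in \<open>simp_all add: left_diff_distrib Q_def\<close>)
      have I2: "norm (contour_integral L (\<lambda>z. S N z * p z * K z)) \<le> 4*C/R\<^sup>2 * R * \<bar>3*pi/2 - pi/2\<bar>"
        unfolding L_def
      proof (rule contour_integral_bound_part_circlepath)
        fix z assume "z \<in> path_image (part_circlepath 0 R (pi/2) (3*pi/2))"
        then have z: "norm z = R" "Re z \<le> 0" using Li L_def by auto
        show "norm (S N z * p z * K z) \<le> 4*C/R\<^sup>2"
        proof (cases "Re z = 0")
          case True then show ?thesis using Kbd[OF z(1)] C0 by (simp add: norm_mult)
        next
          case False
          define y where "y = -Re z"
          have y: "0 < y" "Re z = -y" using z False by (auto simp: y_def)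
          \<comment> \<open>With y <= R <= N, the factor y (1/y + 1/N) is at most 2.\<close>
          have yN: "y \<le> N" using abs_Re_le_cmod[of z] z N y by simp
          have "norm (S N z * p z * K z) \<le> C * (real N powr y * (1/y + 1/N)) * real N powr -y * (2 * y / R\<^sup>2)"
            unfolding norm_mult np Kbd[OF z(1)] using head[OF y(2,1) N(1)] y C0 by (intro mult_mono) auto
          also have "\<dots> = C * (real N powr y * real N powr -y) * (2 * (y * (1/y + 1/N))) / R\<^sup>2"
            by simp
          also have "real N powr y * real N powr -y = 1" using N by (simp flip: powr_add)
          also have "C * 1 * (2 * (y * (1/y + 1/N))) / R\<^sup>2 \<le> C * 1 * (2 * 2) / R\<^sup>2"
            using y yN C0 N by (intro divide_right_mono mult_left_mono) (auto simp: field_simps)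
          finally show ?thesis by (simp add: mult.commute)
        qed
      qed (use C0 R iLS in \<open>simp_all add: L_def\<close>)
      have "2*pi * norm (f 1 - S N 0) = norm (2*pi*\<i> * (f 1 - S N 0))"
        by (simp add: norm_mult)
      also have "\<dots> \<le> 2*C/R\<^sup>2 * R * \<bar>pi/2 - (-pi/2)\<bar> + norm (E N) + 4*C/R\<^sup>2 * R * \<bar>3*pi/2 - pi/2\<bar>"
        unfolding eq using I1 I2 by (intro order_trans[OF norm_triangle_ineq4] add_mono order_trans[OF norm_triangle_ineq]) simp_all
      also have "\<dots> = 2*pi * (3*C/R) + norm (E N)"
        using R by (simp add: field_simps power2_eq_square)
      also have "\<dots> \<le> 2*pi * (3*C/R) + 2*pi * norm (E N)"
        using pi_ge_two mult_right_mono[of 1 "2*pi" "norm (E N)"] by simp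
      finally have "2*pi * norm (f 1 - S N 0) \<le> 2*pi * (3*C/R + norm (E N))"
        by (simp add: algebra_simps)
      then show ?thesis by (simp only: mult_le_cancel_left_pos pi_gt_zero zero_less_mult_iff zero_less_numeral simp_thms)
    qed
    have "\<forall>\<^sub>F N in sequentially. norm (E N) < e/2"
      using tendstoD[OF E0, of "e/2"] e by (simp add: dist_norm)
    moreover have "\<forall>\<^sub>F N in sequentially. R \<le> real N"
      using eventually_ge_at_top[of "nat \<lceil>R\<rceil>"] by eventually_elim linarith
    ultimately show ?thesis
      using eventually_gt_at_top[of 0]
    proof eventually_elim
      case (elim N)
      then show ?case using bound[of N] RC by (simp add: dist_norm norm_minus_commute)
    qed
  qed
  then have "(\<lambda>N. S N 0) \<longlonglongrightarrow> f 1" by (rule tendstoI)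
  then show ?thesis by (simp add: S0 sums_def)
qed

section \<open>Chebyshev's function\<close>

definition chebyshev_psi :: "nat \<Rightarrow> real" where
  "chebyshev_psi n = (\<Sum>k=1..n. mangoldt k)"

lemma chebyshev_psi_0 [simp]: "chebyshev_psi 0 = 0"
  and chebyshev_psi_Suc: "chebyshev_psi (Suc n) = chebyshev_psi n + mangoldt (Suc n)"
  by (simp_all add: chebyshev_psi_def)

lemma chebyshev_psi_mono: "m \<le> n \<Longrightarrow> chebyshev_psi m \<le> chebyshev_psi n"
  unfolding chebyshev_psi_def by (intro sum_mono2) (auto simp: mangoldt_nonneg)

lemma chebyshev_psi_nonneg: "0 \<le> chebyshev_psi n"
  using chebyshev_psi_mono[of 0 n] by simp

text \<open>Expand log k as the sum of Lambda over its divisors: d divides \<open>n div d\<close> of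
  the numbers up to n. The summation bound \<open>N\<close> may exceed \<open>n\<close>, so that n
  and 2n can be compared over a common range.\<close>

lemma sum_ln_eq_sum_mangoldt:
  "n \<le> N \<Longrightarrow> (\<Sum>k=1..n. ln (real k)) = (\<Sum>d=1..N. mangoldt d * real (n div d))"
proof (induction n)
  case 0
  then show ?case by simp
next
  case (Suc n)
  have "ln (real (Suc n)) = (\<Sum>d | d dvd Suc n. mangoldt d)"
    by (subst mangoldt_sum) auto
  also have "\<dots> = (\<Sum>d\<in>{1..N}. if d dvd Suc n then mangoldt d else 0)"
  proof (rule sum.mono_neutral_cong_left)
    have "1 \<le> d \<and> d \<le> N" if "d dvd Suc n" for d
      using that Suc.prems dvd_imp_le[OF that] dvd_pos_nat[of "Suc n" d] by auto
    then show "{d. d dvd Suc n} \<subseteq> {1..N}" by auto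
  qed auto
  finally have "(\<Sum>k=1..Suc n. ln (real k)) =
      (\<Sum>d=1..N. mangoldt d * real (n div d) + (if d dvd Suc n then mangoldt d else 0))"
    using Suc by (simp add: sum.distrib)
  also have "\<dots> = (\<Sum>d=1..N. mangoldt d * real (Suc n div d))"
    by (intro sum.cong refl) (auto simp: div_Suc algebra_simps)
  finally show ?case .
qed

text \<open>In log of (2n)!/(n!)^2, written through Lambda, the weight of d is
  \<open>2*n div d\<close> minus twice \<open>n div d\<close>: never negative, and at least 1 for n
  < d <= 2n. The central binomial coefficient is at most 4^n.\<close>

lemma chebyshev_psi_double: "chebyshev_psi (2*n) - chebyshev_psi n \<le> 2 * real n * ln 2"
proof -
  have l: "(\<Sum>k=1..n. ln (real k)) = (\<Sum>d=1..2*n. mangoldt d * real (n div d))"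
    by (intro sum_ln_eq_sum_mangoldt) auto
  have lnfact: "(\<Sum>k=1..m. ln (real k)) = ln (fact m)" for m
    by (induction m) (auto simp: ln_mult)
  have "{1..2*n} - {1..n} = {n+1..2*n}" by auto
  then have "chebyshev_psi (2*n) - chebyshev_psi n = (\<Sum>d=n+1..2*n. mangoldt d)"
    unfolding chebyshev_psi_def using sum_diff[of "{1..2*n}" "{1..n}" "mangoldt :: nat \<Rightarrow> real"] by auto
  also have "\<dots> = (\<Sum>d\<in>{1..2*n}. if n < d then mangoldt d else 0)"
    by (intro sum.mono_neutral_cong_left) auto
  also have "\<dots> \<le> (\<Sum>d=1..2*n. mangoldt d * (real (2*n div d) - 2 * real (n div d)))"
  proof (rule sum_mono)
    fix d assume d: "d \<in> {1..2*n}"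
    have "2 * (n div d) \<le> 2 * n div d"
      using d by (simp add: less_eq_div_iff_mult_less_eq algebra_simps)
    then have "0 \<le> real (2*n div d) - 2 * real (n div d)"
      by (metis diff_ge_0_iff_ge of_nat_le_iff of_nat_mult of_nat_numeral)
    moreover have "1 \<le> real (2*n div d) - 2 * real (n div d)" if "n < d"
    proof -
      have "2 * n div d \<ge> 1" using d by (simp add: less_eq_div_iff_mult_less_eq)
      then show ?thesis using that by simp
    qed
    ultimately show "(if n < d then mangoldt d else 0) \<le> mangoldt d * (real (2*n div d) - 2 * real (n div d))"
      using mangoldt_nonneg[of d] mult_left_mono[of 1 "real (2*n div d) - 2 * real (n div d)" "mangoldt d"] by auto
  qed
  also have "\<dots> = (\<Sum>k=1..2*n. ln (real k)) - 2 * (\<Sum>k=1..n. ln (real k))"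
    unfolding sum_ln_eq_sum_mangoldt[of "2*n" "2*n", OF order_refl] l
    by (simp add: sum_subtractf sum_distrib_left algebra_simps)
  also have "\<dots> = ln (fact (2*n) / (fact n * fact n))"
    unfolding lnfact by (simp add: ln_div ln_mult)
  also have "fact (2*n) / (fact n * fact n) = real (2*n choose n)"
    by (simp add: binomial_fact mult_2)
  also have "ln (real (2*n choose n)) \<le> ln (2 ^ (2*n))"
    using binomial_le_pow2[of "2*n" n] by (subst ln_le_cancel_iff) (auto simp flip: of_nat_le_iff)
  also have "\<dots> = 2 * real n * ln 2" by (simp add: ln_realpow)
  finally show ?thesis .
qed

text \<open>Halving, with m = n/2 rounded up: 6m + 2m = 8m <= 4(n+1) <= 6n as soon as n >= 2, which
  explains the constant 6.\<close>

lemma chebyshev_psi_le: "chebyshev_psi n \<le> 6 * real n"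
proof -
  have "chebyshev_psi n \<le> 6 * ln 2 * real n"
  proof (induction n rule: less_induct)
    case (less n)
    show ?case
    proof (cases "n < 2")
      case True
      then have "n = 0 \<or> n = 1" by auto
      then show ?thesis by (auto simp: chebyshev_psi_def)
    next
      case False
      define m where "m = (n + 1) div 2"
      have m: "m < n" "n \<le> 2 * m" "2 * m \<le> n + 1" using False by (auto simp: m_def)
      have "chebyshev_psi n \<le> chebyshev_psi (2 * m)" using m by (intro chebyshev_psi_mono)
      also have "\<dots> \<le> chebyshev_psi m + 2 * real m * ln 2" using chebyshev_psi_double[of m] by simp
      also have "\<dots> \<le> 6 * ln 2 * real m + 2 * real m * ln 2" using less[OF m(1)] by linarith
      also have "\<dots> = ln 2 * (8 * real m)" by (simp add: algebra_simps)
      also have "\<dots> \<le> ln 2 * (6 * real n)" using m(3) False by (intro mult_left_mono) auto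
      finally show ?thesis by (simp add: algebra_simps)
    qed
  qed
  also have "6 * ln 2 * real n \<le> 6 * 1 * real n"
    using ln_le_minus_one[of "2::real"] by (intro mult_mono) auto
  finally show ?thesis by simp
qed

section \<open>The zeta function\<close>

lemma summable_Suc_powr: "0 < e \<Longrightarrow> summable (\<lambda>n. real (Suc n) powr (-1-e))"
  by (subst summable_Suc_iff[of "\<lambda>n. real n powr (-1-e)"]) (simp add: summable_real_powr_iff)

text \<open>Weierstrass' test: near x the exponent stays below -1-e, with e half the distance of x
  from the line Re s = c, and the continuous factor \<open>B\<close> is bounded on a closed ball. It
  serves zeta with c = 1 and the two correction series with c = 0.\<close>

lemma holomorphic_Dirichlet:
  fixes f :: "nat \<Rightarrow> complex \<Rightarrow> complex"
  assumes hol: "\<And>n. f n holomorphic_on {s. c < Re s}"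
    and bd: "\<And>n s. c < Re s \<Longrightarrow> norm (f n s) \<le> B s * real (Suc n) powr (-1 - (Re s - c))"
    and B: "continuous_on UNIV B"
  defines "F \<equiv> (\<lambda>s. \<Sum>n. f n s)"
  shows "F holomorphic_on {s. c < Re s}"
    and "c < Re s \<Longrightarrow> (\<lambda>n. f n s) sums F s"
    and "c < Re s \<Longrightarrow> (\<lambda>n. deriv (f n) s) sums deriv F s"
proof -
  have op: "open {s. c < Re s}" by (rule open_halfspace_Re_gt)
  have loc: "\<exists>d h. 0 < d \<and> summable h \<and> (\<forall>\<^sub>F n in sequentially. \<forall>y\<in>ball x d \<inter> {s. c < Re s}. norm (f n y) \<le> h n)"
    if x: "x \<in> {s. c < Re s}" for x
  proof -
    define e where "e = (Re x - c)/2"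
    have e: "0 < e" using x by (simp add: e_def)
    have "compact (B ` cball x e)" by (intro compact_continuous_image continuous_on_subset[OF B]) auto
    then obtain M where M: "\<And>y. y \<in> cball x e \<Longrightarrow> norm (B y) \<le> M"
      by (metis bounded_iff compact_imp_bounded imageI)
    have M0: "0 \<le> M" using order_trans[OF norm_ge_zero M[of x]] e by simp
    have "norm (f n y) \<le> M * real (Suc n) powr (-1-e)" if y: "y \<in> ball x e \<inter> {s. c < Re s}" for n y
    proof -
      have "\<bar>Re x - Re y\<bar> < e" using y abs_Re_le_cmod[of "x-y"] by (auto simp: dist_norm)
      then have "e \<le> Re y - c" unfolding e_def by argo
      then have "real (Suc n) powr (-1 - (Re y - c)) \<le> real (Suc n) powr (-1-e)"
        by (intro powr_mono) auto
      moreover have "B y \<le> M" using M[of y] y by simp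
      ultimately have "B y * real (Suc n) powr (-1 - (Re y - c)) \<le> M * real (Suc n) powr (-1-e)"
        using M0 by (intro mult_mono) auto
      with bd[of y n] y show ?thesis by simp
    qed
    then show ?thesis using e summable_mult[OF summable_Suc_powr[OF e], of M]
      by (intro exI[of _ e] exI[of _ "\<lambda>n. M * real (Suc n) powr (-1-e)"]) auto
  qed
  have der: "(f n has_field_derivative deriv (f n) x) (at x)" if "x \<in> {s. c < Re s}" for n x
    using holomorphic_derivI[OF hol op that] .
  obtain g g' where g: "\<And>x. c < Re x \<Longrightarrow> ((\<lambda>n. f n x) sums g x) \<and> ((\<lambda>n. deriv (f n) x) sums g' x)
      \<and> (g has_field_derivative g' x) (at x)"
    using series_and_derivative_comparison_local[OF op der loc] by blast
  have Fg: "F s = g s" if "c < Re s" for s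
    using g[OF that] sums_unique[of "\<lambda>n. f n s" "g s"] by (simp add: F_def)
  have Fd: "(F has_field_derivative g' s) (at s)" if "c < Re s" for s
    using has_field_derivative_transform_within_open[of g "g' s" s "{s. c < Re s}" F] g[OF that] op Fg that by auto
  show "F holomorphic_on {s. c < Re s}"
    using Fd op by (auto simp: holomorphic_on_open)
  show "(\<lambda>n. f n s) sums F s" if "c < Re s" using g[OF that] Fg[OF that] by simp
  show "(\<lambda>n. deriv (f n) s) sums deriv F s" if "c < Re s"
    using g[OF that] DERIV_imp_deriv[OF Fd[OF that]] by simp
qed

text \<open>First-order Taylor expansion of z^-w at n with step 1. The second derivative gains two
  powers of n, which is what moves the abscissa of convergence to 0. The condition on
  \<open>Re w\<close> puts its maximum at the left endpoint.\<close>

lemma powr_taylor_bound: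
  assumes "0 < n" "-2 \<le> Re w"
  shows "norm (of_nat (Suc n) powr -w - of_nat n powr -w + w * of_nat n powr (-w-1) :: complex)
    \<le> norm w * norm (w+1) * real n powr (-Re w - 2)"
proof -
  define S where "S = closed_segment (of_nat n) (of_nat (Suc n) :: complex)"
  define f where "f = (\<lambda>i::nat. if i = 0 then (\<lambda>z::complex. z powr -w)
      else if i = 1 then (\<lambda>z. -w * z powr (-w-1)) else (\<lambda>z. w * (w+1) * z powr (-w-2)))"
  have S: "\<exists>t. z = complex_of_real t \<and> real n \<le> t" if z: "z \<in> S" for z
  proof -
    obtain u where u: "0 \<le> u" "z = (1-u) *\<^sub>R of_nat n + u *\<^sub>R of_nat (Suc n)"
      using z by (auto simp: S_def closed_segment_def simp del: of_nat_Suc)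
    have "z = complex_of_real (real n + u)" unfolding u(2) by (simp add: scaleR_conv_of_real algebra_simps)
    then show ?thesis using u(1) by (intro exI[of _ "real n + u"]) auto
  qed
  have "norm (f 0 (of_nat (Suc n)) - (\<Sum>i\<le>1. f i (of_nat n) * (of_nat (Suc n) - of_nat n) ^ i / fact i))
    \<le> (norm w * norm (w+1) * real n powr (-Re w - 2)) * norm (of_nat (Suc n) - of_nat n :: complex) ^ Suc 1 / fact 1"
  proof (rule complex_Taylor[of S])
    fix i z assume z: "z \<in> S" and i: "i \<le> (1::nat)"
    then obtain t where t: "z = complex_of_real t" "real n \<le> t" using S by blast
    have "z \<notin> \<real>\<^sub>\<le>\<^sub>0" using t assms by simp
    then have "((\<lambda>z. z powr -w) has_field_derivative -w * z powr (-w-1)) (at z within S)"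
      "((\<lambda>z. -w * z powr (-w-1)) has_field_derivative w * (w+1) * z powr (-w-2)) (at z within S)"
      by (auto intro!: derivative_eq_intros simp: algebra_simps)
    then show "(f i has_field_derivative f (Suc i) z) (at z within S)"
      using i by (cases i) (auto simp: f_def)
  next
    fix z assume "z \<in> S"
    then obtain t where t: "z = complex_of_real t" "real n \<le> t" using S by blast
    have "norm (z powr (-w-2)) = t powr (-Re w - 2)"
      using t by (subst norm_powr_real_powr) auto
    also have "\<dots> \<le> real n powr (-Re w - 2)" using t assms by (intro powr_mono2') auto
    finally show "norm (f (Suc 1) z) \<le> norm w * norm (w+1) * real n powr (-Re w - 2)"
      by (simp add: f_def norm_mult mult_left_mono)
  qed (auto simp: S_def)
  then show ?thesis by (simp add: f_def algebra_simps)
qed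

text \<open>\<open>(s - 1) \<zeta>(s)\<close>, continued to \<open>Re s > 0\<close> by comparing each \<open>n\<^sup>-\<^sup>s\<close> with its integral over \<open>[n, n+1]\<close>.\<close>

definition zeta_term :: "nat \<Rightarrow> complex \<Rightarrow> complex" where
  "zeta_term n s = of_nat (Suc (Suc n)) powr -(s-1) - of_nat (Suc n) powr -(s-1) + (s-1) * of_nat (Suc n) powr -s"

definition pole_free_zeta :: "complex \<Rightarrow> complex" where
  "pole_free_zeta s = 1 + (\<Sum>n. zeta_term n s)"

lemma zeta_term_bound:
  assumes "0 < Re s"
  shows "norm (zeta_term n s) \<le> norm (s-1) * norm s * real (Suc n) powr (-1 - (Re s - 0))"
  using powr_taylor_bound[of "Suc n" "s-1"] assms by (simp add: zeta_term_def algebra_simps del: of_nat_Suc)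

lemma zeta_term_holomorphic: "zeta_term n holomorphic_on A"
  unfolding zeta_term_def by (intro holomorphic_intros)

lemma continuous_zeta_bound: "continuous_on UNIV (\<lambda>s::complex. norm (s-1) * norm s)"
  by (intro continuous_intros)

lemma pole_free_zeta_holomorphic: "pole_free_zeta holomorphic_on {s. 0 < Re s}"
  unfolding pole_free_zeta_def[abs_def]
  using holomorphic_Dirichlet(1)[of zeta_term 0, OF zeta_term_holomorphic zeta_term_bound continuous_zeta_bound]
  by (intro holomorphic_intros)

lemma pole_free_zeta_1 [simp]: "pole_free_zeta 1 = 1"
  by (simp add: pole_free_zeta_def zeta_term_def del: of_nat_Suc)

lemma norm_Suc_powr: "norm (of_nat (Suc n) powr -s :: complex) = real (Suc n) powr (-1 - (Re s - 1))"
  by (simp add: norm_of_nat_powr del: of_nat_Suc)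

text \<open>Only the values for Re s > 1 matter; further left \<open>pole_free_zeta\<close> takes
  over.\<close>

definition zeta :: "complex \<Rightarrow> complex" where
  "zeta s = (\<Sum>n. of_nat (Suc n) powr -s)"

lemma zeta_series:
  shows zeta_holomorphic: "zeta holomorphic_on {s. 1 < Re s}"
    and zeta_sums: "1 < Re s \<Longrightarrow> (\<lambda>n. of_nat (Suc n) powr -s) sums zeta s"
    and zeta_deriv_sums: "1 < Re s \<Longrightarrow> (\<lambda>n. of_real (ln (real (Suc n))) * of_nat (Suc n) powr -s) sums (- deriv zeta s)"
proof -
  have h: "(\<lambda>s. of_nat (Suc n) powr -s :: complex) holomorphic_on {s. 1 < Re s}" for n
    by (intro holomorphic_intros)
  have b: "norm (of_nat (Suc n) powr -s :: complex) \<le> 1 * real (Suc n) powr (-1 - (Re s - 1))" for n s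
    unfolding norm_Suc_powr by simp
  note * = holomorphic_Dirichlet[OF h b continuous_on_const]
  have zeq: "zeta = (\<lambda>s. \<Sum>n. of_nat (Suc n) powr -s)" by (simp add: zeta_def fun_eq_iff)
  show "zeta holomorphic_on {s. 1 < Re s}" unfolding zeq by (rule *(1))
  show "(\<lambda>n. of_nat (Suc n) powr -s) sums zeta s" if "1 < Re s" unfolding zeq by (rule *(2)[OF that])
  have "((\<lambda>s. of_nat (Suc n) powr -s :: complex) has_field_derivative
      - (of_real (ln (real (Suc n))) * of_nat (Suc n) powr -s)) (at s)" for n s
  proof -
    have "((\<lambda>z. of_nat (Suc n) powr z :: complex) has_field_derivative
        Ln (of_nat (Suc n)) * of_nat (Suc n) powr -s) (at (-s))"
      by (intro has_field_derivative_powr_right) (simp del: of_nat_Suc)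
    moreover have "(uminus has_field_derivative -1) (at s)"
      by (auto intro!: derivative_eq_intros)
    ultimately show ?thesis
      using DERIV_chain2[where g = uminus] by (fastforce simp: Ln_of_nat simp del: of_nat_Suc)
  qed
  then have d: "deriv (\<lambda>s. of_nat (Suc n) powr -s :: complex) s = - (of_real (ln (real (Suc n))) * of_nat (Suc n) powr -s)" for n s
    by (rule DERIV_imp_deriv)
  show "(\<lambda>n. of_real (ln (real (Suc n))) * of_nat (Suc n) powr -s) sums (- deriv zeta s)" if "1 < Re s"
    using sums_minus[OF *(3)[OF that]] unfolding d zeq by simp
qed

lemma powr_minus_tendsto_0:
  assumes "0 < Re w" shows "(\<lambda>n. of_nat (Suc n) powr -w :: complex) \<longlonglongrightarrow> 0"
proof (rule tendsto_norm_zero_cancel)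
  have "(\<lambda>n. real (Suc n) powr (-Re w)) \<longlonglongrightarrow> 0"
    using assms by (intro tendsto_neg_powr filterlim_compose[OF filterlim_real_sequentially filterlim_Suc]) auto
  then show "(\<lambda>n. norm (of_nat (Suc n) powr -w :: complex)) \<longlonglongrightarrow> 0"
    by (simp add: norm_of_nat_powr del: of_nat_Suc)
qed

text \<open>The differences in \<open>zeta_term\<close> telescope to -1, which the constant 1 in
  \<open>pole_free_zeta\<close> undoes.\<close>

lemma pole_free_zeta_eq:
  assumes "1 < Re s" shows "pole_free_zeta s = (s - 1) * zeta s"
proof -
  have "(\<lambda>n. of_nat (Suc (Suc n)) powr -(s-1) - of_nat (Suc n) powr -(s-1) :: complex) sums (0 - of_nat (Suc 0) powr -(s-1))"
    using assms by (intro telescope_sums powr_minus_tendsto_0) auto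
  from sums_add[OF this sums_mult[OF zeta_sums[OF assms], of "s-1"]]
  have "(\<lambda>n. zeta_term n s) sums ((s-1) * zeta s - 1)"
    by (simp add: zeta_term_def)
  then show ?thesis by (simp add: pole_free_zeta_def sums_unique[symmetric])
qed

section \<open>Non-vanishing on the line \<open>Re s = 1\<close>\<close>

text \<open>Absolute convergence makes the double sum unordered, so the pairs (d, m) can be
  regrouped by their product n = d m.\<close>

lemma Dirichlet_product_has_sum:
  fixes f g :: "nat \<Rightarrow> complex"
  assumes f: "(f has_sum F) {1..}" "(\<lambda>n. norm (f n)) summable_on {1..}"
    and g: "(g has_sum G) {1..}" "(\<lambda>n. norm (g n)) summable_on {1..}"
  shows "((\<lambda>n. \<Sum>d | d dvd n. f d * g (n div d)) has_sum (F * G)) {1..}"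
proof -
  have abs: "(\<lambda>x. norm ((\<lambda>(d,m). f d * g m) x)) summable_on {1..} \<times> {1..}"
    unfolding Infinite_Sum.abs_summable_on_Sigma_iff
  proof (intro conjI ballI)
    fix d :: nat show "(\<lambda>m. norm (case (d, m) of (d, m) \<Rightarrow> f d * g m)) summable_on {1..}"
      using summable_on_cmult_right[OF g(2), of "norm (f d)"] by (simp add: norm_mult)
  next
    have "infsum (\<lambda>m. norm (case (d, m) of (d, m) \<Rightarrow> f d * g m)) {1..} = norm (f d) * infsum (\<lambda>m. norm (g m)) {1..}" for d
      using infsum_cmult_right[OF g(2), of "norm (f d)"] by (simp add: norm_mult)
    moreover have "0 \<le> infsum (\<lambda>m. norm (g m)) {1..}" by (intro infsum_nonneg) auto
    ultimately show "(\<lambda>d. norm (infsum (\<lambda>m. norm (case (d, m) of (d, m) \<Rightarrow> f d * g m)) {1..})) summable_on {1..}"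
      using summable_on_cmult_left[OF f(2)] by (simp add: abs_mult)
  qed
  from abs have "(\<lambda>(d,m). f d * g m) summable_on {1..} \<times> {1..}"
    by (rule abs_summable_summable)
  then have "((\<lambda>(d,m). f d * g m) has_sum (F * G)) ({1..} \<times> {1..})"
    using has_sum_cmult_right[OF g(1)] has_sum_cmult_left[OF f(1)]
    by (intro has_sum_SigmaI[where g = "\<lambda>d. f d * G"]) auto
  also have "?this \<longleftrightarrow> ((\<lambda>(n,d). f d * g (n div d)) has_sum (F * G)) (Sigma {1..} (\<lambda>n. {d. d dvd n}))"
    by (rule has_sum_reindex_bij_witness[of _ "\<lambda>(n,d). (d, n div d)" "\<lambda>(d,m). (d*m, d)"])
       (auto simp: Suc_le_eq elim!: dvdE)
  finally show ?thesis
    by (rule has_sum_SigmaD) (auto intro!: has_sum_finite)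
qed

lemma has_sum_atLeast_1_iff:
  fixes f :: "nat \<Rightarrow> 'a::{topological_comm_monoid_add,t2_space}"
  shows "(f has_sum x) {1..} \<longleftrightarrow> ((\<lambda>n. f (Suc n)) has_sum x) UNIV"
proof -
  have "bij_betw Suc UNIV {1..}" by (rule bij_betwI[of _ _ _ "\<lambda>n. n - 1"]) auto
  from has_sum_reindex_bij_betw[OF this, of f x] show ?thesis by simp
qed

lemma sums_imp_has_sum_atLeast_1:
  fixes f :: "nat \<Rightarrow> complex"
  assumes "(\<lambda>n. f (Suc n)) sums x" "summable (\<lambda>n. norm (f (Suc n)))"
  shows "(f has_sum x) {1..}" "(\<lambda>n. norm (f n)) summable_on {1..}"
proof -
  show "(f has_sum x) {1..}"
    unfolding has_sum_atLeast_1_iff using assms by (intro norm_summable_imp_has_sum)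
  have "((\<lambda>n. norm (f (Suc n))) has_sum (\<Sum>n. norm (f (Suc n)))) UNIV"
    using assms by (intro norm_summable_imp_has_sum summable_sums) auto
  then show "(\<lambda>n. norm (f n)) summable_on {1..}"
    unfolding has_sum_atLeast_1_iff[of "\<lambda>n. norm (f n)", symmetric] by (rule has_sum_imp_summable)
qed

text \<open>These are the terms of -zeta' at a real point, so termwise differentiation already gives
  convergence.\<close>

lemma summable_ln_powr:
  assumes "1 < \<sigma>"
  shows "summable (\<lambda>n. ln (real (Suc n)) * real (Suc n) powr -\<sigma>)"
proof -
  have "of_nat (Suc n) powr - complex_of_real \<sigma> = of_real (real (Suc n) powr -\<sigma>)" for n
    using powr_of_real[of "real (Suc n)" "-\<sigma>"] by (simp del: of_nat_Suc)
  then have "(\<lambda>n. complex_of_real (ln (real (Suc n)) * real (Suc n) powr -\<sigma>)) sums (- deriv zeta (of_real \<sigma>))"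
    using zeta_deriv_sums[of "of_real \<sigma>"] assms by (simp del: of_nat_Suc)
  from sums_Re[OF this] show ?thesis by (simp add: sums_iff)
qed

definition mangoldt_series :: "complex \<Rightarrow> complex" where
  "mangoldt_series s = (\<Sum>n. mangoldt (Suc n) * of_nat (Suc n) powr -s)"

lemma norm_mangoldt_term_le:
  "norm (mangoldt (Suc n) * of_nat (Suc n) powr -s :: complex) \<le> ln (real (Suc n)) * real (Suc n) powr -Re s"
  unfolding norm_mult norm_of_nat_powr using mangoldt_le[of "Suc n"]
  by (simp add: mult_right_mono del: of_nat_Suc)

text \<open>The last bound depends on Re s alone and its terms decrease in Re s, so it is uniform on
  every half-plane strictly to the right of the line Re s = 1.\<close>

lemma
  assumes "1 < Re s"
  shows summable_norm_mangoldt_series: "summable (\<lambda>n. norm (mangoldt (Suc n) * of_nat (Suc n) powr -s :: complex))"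
    and mangoldt_sums: "(\<lambda>n. mangoldt (Suc n) * of_nat (Suc n) powr -s) sums mangoldt_series s"
    and norm_mangoldt_series_le: "norm (mangoldt_series s) \<le> (\<Sum>n. ln (real (Suc n)) * real (Suc n) powr -Re s)"
proof -
  note ln = summable_ln_powr[OF assms]
  show sn: "summable (\<lambda>n. norm (mangoldt (Suc n) * of_nat (Suc n) powr -s :: complex))"
    using norm_mangoldt_term_le by (intro summable_comparison_test[OF _ ln]) auto
  from summable_norm_cancel[OF this]
  show "(\<lambda>n. mangoldt (Suc n) * of_nat (Suc n) powr -s) sums mangoldt_series s"
    unfolding mangoldt_series_def by (rule summable_sums)
  show "norm (mangoldt_series s) \<le> (\<Sum>n. ln (real (Suc n)) * real (Suc n) powr -Re s)"
    unfolding mangoldt_series_def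
    by (rule order_trans[OF summable_norm[OF sn]]) (intro suminf_le norm_mangoldt_term_le sn ln)
qed

text \<open>The identity log n = sum of Lambda(d) over d dividing n, read as a Dirichlet product;
  the powers combine since d^-s (n/d)^-s = n^-s.\<close>

lemma mangoldt_series_mult_zeta:
  assumes s: "1 < Re s"
  shows "mangoldt_series s * zeta s = - deriv zeta s"
proof -
  have nz: "summable (\<lambda>n. norm (of_nat (Suc n) powr -s :: complex))"
    unfolding norm_Suc_powr using summable_Suc_powr[of "Re s - 1"] s by simp
  have nl: "summable (\<lambda>n. norm (of_real (ln (real (Suc n))) * of_nat (Suc n) powr -s :: complex))"
    using summable_ln_powr[OF s] by (simp add: norm_mult norm_of_nat_powr del: of_nat_Suc)
  have "((\<lambda>n. \<Sum>d | d dvd n. mangoldt d * of_nat d powr -s * of_nat (n div d) powr -s)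
      has_sum mangoldt_series s * zeta s) {1..}"
    using sums_imp_has_sum_atLeast_1[OF mangoldt_sums[OF s] summable_norm_mangoldt_series[OF s]]
      sums_imp_has_sum_atLeast_1[OF zeta_sums[OF s] nz]
    by (rule Dirichlet_product_has_sum)
  also have "?this \<longleftrightarrow> ((\<lambda>n. of_real (ln (real n)) * of_nat n powr -s) has_sum mangoldt_series s * zeta s) {1..}"
  proof (rule has_sum_cong)
    fix n :: nat assume "n \<in> {1..}"
    then have n: "n \<noteq> 0" by auto
    have "mangoldt d * of_nat d powr -s * of_nat (n div d) powr -s = mangoldt d * (of_nat n powr -s :: complex)"
      if "d dvd n" for d
      using that by (auto elim!: dvdE simp: powr_times_real mult.assoc)
    then have "(\<Sum>d | d dvd n. mangoldt d * of_nat d powr -s * of_nat (n div d) powr -s)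
        = (\<Sum>d | d dvd n. mangoldt d) * (of_nat n powr -s :: complex)"
      unfolding sum_distrib_right by (intro sum.cong) auto
    then show "(\<Sum>d | d dvd n. mangoldt d * of_nat d powr -s * of_nat (n div d) powr -s)
        = of_real (ln (real n)) * (of_nat n powr -s :: complex)"
      using mangoldt_sum[OF n, where ?'a = complex] by simp
  qed
  finally show ?thesis
    using sums_imp_has_sum_atLeast_1(1)[OF zeta_deriv_sums[OF s] nl] has_sum_unique by blast
qed

text \<open>The logarithmic derivative of (s-1) zeta(s). Non-vanishing is assumed here because its
  proof below goes through this formula.\<close>

lemma mangoldt_series_eq:
  assumes s: "1 < Re s" and nz: "pole_free_zeta s \<noteq> 0"
  shows "mangoldt_series s = 1/(s-1) - deriv pole_free_zeta s / pole_free_zeta s"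
proof -
  have s1: "s \<noteq> 1" using s by auto
  have op: "open {s. 1 < Re s}" by (rule open_halfspace_Re_gt)
  have "((\<lambda>s. (s-1) * zeta s) has_field_derivative (zeta s + (s-1) * deriv zeta s)) (at s)"
    using holomorphic_derivI[OF zeta_holomorphic op, of s] s by (auto intro!: derivative_eq_intros)
  then have "(pole_free_zeta has_field_derivative (zeta s + (s-1) * deriv zeta s)) (at s)"
    by (rule has_field_derivative_transform_within_open[OF _ op]) (use s pole_free_zeta_eq in auto)
  then have "deriv pole_free_zeta s = zeta s + (s-1) * deriv zeta s" by (rule DERIV_imp_deriv)
  also have "deriv zeta s = - mangoldt_series s * zeta s" using mangoldt_series_mult_zeta[OF s] by simp
  finally have "deriv pole_free_zeta s / pole_free_zeta s = 1/(s-1) - mangoldt_series s"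
    using nz s1 by (simp add: pole_free_zeta_eq[OF s] diff_divide_distrib)
  then show ?thesis by simp
qed

section \<open>Orders of zeros read off from logarithmic derivatives\<close>

text \<open>Writing f = (z-a)^m g with g zero-free near a gives f'/f = m/(z-a) + g'/g. The point
  \<open>b\<close> excludes f = 0, so the order is finite. The approach is from the right, where the
  Dirichlet series is available.\<close>

lemma log_deriv_order:
  assumes f: "f holomorphic_on S" and S: "open S" "connected S" "a \<in> S" and b: "b \<in> S" "f b \<noteq> 0"
  obtains m :: nat where "m = 0 \<longleftrightarrow> f a \<noteq> 0"
    "\<forall>\<^sub>F e in at_right (0::real). f (a + of_real e) \<noteq> 0"
    "((\<lambda>e. of_real e * (deriv f (a + of_real e) / f (a + of_real e))) \<longlongrightarrow> of_nat m) (at_right 0)"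
proof -
  obtain m r g where m: "m = 0 \<longleftrightarrow> f a \<noteq> 0" and r: "0 < r" "ball a r \<subseteq> S" and g: "g holomorphic_on ball a r"
    "\<And>w. w \<in> ball a r \<Longrightarrow> f w = (w - a) ^ m * g w" "\<And>w. w \<in> ball a r \<Longrightarrow> g w \<noteq> 0"
  \<comment> \<open>The factorisation theorem wants a zero at a; otherwise m = 0, g = f works near a
    by continuity.\<close>
  proof (cases "f a = 0")
    case True
    then have nc: "\<not> f constant_on S" using S(3) b by (metis constant_on_def)
    obtain g r n where gr: "0 < n"  "0 < r"  "ball a r \<subseteq> S" "g holomorphic_on ball a r"
            "\<And>w. w \<in> ball a r \<Longrightarrow> f w = (w - a)^n * g w" "\<And>w. w \<in> ball a r \<Longrightarrow> g w \<noteq> 0"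
      by (rule holomorphic_factor_zero_nonconstant[OF f S True nc]) (rule that)
    show ?thesis by (rule that[of n r g]) (use True gr in auto)
  next
    case False
    have "isCont f a"
      using bspec[OF iffD1[OF continuous_on_eq_continuous_at[OF S(1)] holomorphic_on_imp_continuous_on[OF f]] S(3)] .
    then obtain r1 where r1: "0 < r1" "\<And>y. dist a y < r1 \<Longrightarrow> f y \<noteq> 0"
      using continuous_at_avoid[of a f 0] False by auto
    obtain r2 where r2: "0 < r2" "ball a r2 \<subseteq> S" using S open_contains_ball by blast
    show ?thesis
    proof (rule that[of 0 "min r1 r2" f])
      show sub: "ball a (min r1 r2) \<subseteq> S" using r2 by auto
      show "f holomorphic_on ball a (min r1 r2)" using holomorphic_on_subset[OF f sub] .
    qed (use False r1 r2 in auto)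
  qed
  have w: "a + of_real e \<in> ball a r" if "0 < e" "e < r" for e
    using that by (simp add: dist_norm)
  have ev: "\<forall>\<^sub>F e in at_right (0::real). 0 < e \<and> e < r"
    using eventually_at_right_real[OF r(1)] by simp
  have eq: "of_real e * (deriv f (a + of_real e) / f (a + of_real e))
      = of_nat m + of_real e * (deriv g (a + of_real e) / g (a + of_real e))" if "0 < e" "e < r" for e
  proof -
    define z where "z = a + complex_of_real e"
    have z: "z \<in> ball a r" unfolding z_def using w that by auto
    have "((\<lambda>w. (w - a) ^ m * g w) has_field_derivative (of_nat m * (z - a)^(m-1) * g z + (z-a)^m * deriv g z)) (at z)"
    proof -
      have "((\<lambda>w. (w - a) ^ m) has_field_derivative of_nat m * (z - a)^(m-1)) (at z)"
        by (auto intro!: derivative_eq_intros)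
      from DERIV_mult[OF this holomorphic_derivI[OF g(1) open_ball z]] show ?thesis
        by (simp add: mult.commute add.commute)
    qed
    then have "(f has_field_derivative (of_nat m * (z - a)^(m-1) * g z + (z-a)^m * deriv g z)) (at z)"
      by (rule has_field_derivative_transform_within_open[OF _ open_ball z]) (use g(2) in simp)
    then have d: "deriv f z = of_nat m * (z - a)^(m-1) * g z + (z-a)^m * deriv g z" by (rule DERIV_imp_deriv)
    have "z - a \<noteq> 0" using that by (simp add: z_def)
    then have "(z - a) * deriv f z = (z-a)^m * (of_nat m * g z + (z-a) * deriv g z)"
      unfolding d by (cases m) (auto simp: algebra_simps)
    then have "(z - a) * (deriv f z / f z) = (z-a)^m * (of_nat m * g z + (z-a) * deriv g z) / ((z-a)^m * g z)"
      using g(2)[OF z] by simp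
    also have "\<dots> = (of_nat m * g z + (z-a) * deriv g z) / g z"
      using \<open>z - a \<noteq> 0\<close> by simp
    also have "\<dots> = of_nat m + (z-a) * (deriv g z / g z)"
      using g(3)[OF z] by (simp add: add_divide_distrib)
    finally have "(z - a) * (deriv f z / f z) = of_nat m + (z-a) * (deriv g z / g z)" .
    then show ?thesis by (simp add: z_def)
  qed
  have "((\<lambda>e. a + complex_of_real e) \<longlongrightarrow> a + of_real 0) (at_right 0)"
    by (intro tendsto_intros)
  then have lim: "((\<lambda>e. a + complex_of_real e) \<longlongrightarrow> a) (at_right 0)" by simp
  have a: "a \<in> ball a r" using r by simp
  note cont = bspec[OF iffD1[OF continuous_on_eq_continuous_at[OF open_ball] holomorphic_on_imp_continuous_on] a]
  note lims = isCont_tendsto_compose[OF cont[OF g(1)] lim]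
    isCont_tendsto_compose[OF cont[OF holomorphic_deriv[OF g(1) open_ball]] lim]
  have "((\<lambda>e. of_nat m + of_real e * (deriv g (a + of_real e) / g (a + of_real e)))
     \<longlongrightarrow> of_nat m + of_real 0 * (deriv g a / g a)) (at_right 0)"
    using g(3)[OF a] by (intro tendsto_intros lims)
  then have lim': "((\<lambda>e. of_nat m + of_real e * (deriv g (a + of_real e) / g (a + of_real e)))
     \<longlongrightarrow> of_nat m) (at_right 0)" by simp
  have "\<forall>\<^sub>F e in at_right 0. of_nat m + of_real e * (deriv g (a + of_real e) / g (a + of_real e))
      = of_real e * (deriv f (a + of_real e) / f (a + of_real e))"
    using ev by eventually_elim (use eq in auto)
  from Lim_transform_eventually[OF lim' this]
  have "((\<lambda>e. of_real e * (deriv f (a + of_real e) / f (a + of_real e))) \<longlongrightarrow> of_nat m) (at_right 0)" .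
  moreover have "\<forall>\<^sub>F e in at_right (0::real). f (a + of_real e) \<noteq> 0"
    using ev
  proof eventually_elim
    case (elim e)
    then have "a + of_real e \<in> ball a r" "a + of_real e - a \<noteq> 0" using w by auto
    then show ?case using g(2,3) by simp
  qed
  ultimately show ?thesis using m by (intro that)
qed

text \<open>The limit is the residue of -zeta'/zeta: the pole of zeta at 1 contributes 1, a zero of
  order m contributes -m.\<close>

lemma mangoldt_series_residue:
  assumes "1 \<le> Re a"
  obtains m :: nat where "m = 0 \<longleftrightarrow> pole_free_zeta a \<noteq> 0"
    "((\<lambda>e. of_real e * mangoldt_series (a + of_real e)) \<longlongrightarrow> (if a = 1 then 1 else 0) - of_nat m) (at_right 0)"
proof -
  have dom: "open {s. 0 < Re s}" "connected {s. 0 < Re s}" "a \<in> {s. 0 < Re s}" "1 \<in> {s. 0 < Re s}"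
    using open_halfspace_Re_gt convex_connected[OF convex_halfspace_Re_gt] assms by auto
  have "pole_free_zeta 1 \<noteq> 0" by simp
  from log_deriv_order[OF pole_free_zeta_holomorphic dom this]
  obtain m :: nat where m: "m = 0 \<longleftrightarrow> pole_free_zeta a \<noteq> 0"
    "\<forall>\<^sub>F e in at_right (0::real). pole_free_zeta (a + of_real e) \<noteq> 0"
    "((\<lambda>e. of_real e * (deriv pole_free_zeta (a + of_real e) / pole_free_zeta (a + of_real e))) \<longlongrightarrow> of_nat m) (at_right 0)"
    .
  have "((\<lambda>e. of_real e / (a + of_real e - 1)) \<longlongrightarrow> (if a = 1 then 1 else 0)) (at_right (0::real))"
  proof (cases "a = 1")
    case True
    have "\<forall>\<^sub>F e in at_right (0::real). 0 < e" by (simp add: eventually_at_right_less)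
    then have "\<forall>\<^sub>F e in at_right (0::real). 1 = of_real e / (a + of_real e - 1)"
      by eventually_elim (use True in auto)
    from Lim_transform_eventually[OF tendsto_const this] True show ?thesis by simp
  next
    case False
    then have "((\<lambda>e. of_real e / (a + of_real e - 1)) \<longlongrightarrow> of_real 0 / (a + of_real 0 - 1)) (at_right (0::real))"
      by (intro tendsto_intros) auto
    then show ?thesis using False by simp
  qed
  from tendsto_diff[OF this m(3)]
  have lim: "((\<lambda>e. of_real e / (a + of_real e - 1) -
      of_real e * (deriv pole_free_zeta (a + of_real e) / pole_free_zeta (a + of_real e)))
      \<longlongrightarrow> (if a = 1 then 1 else 0) - of_nat m) (at_right 0)" .
  have "\<forall>\<^sub>F e in at_right (0::real). 0 < e" by (simp add: eventually_at_right_less)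
  with m(2) have ev: "\<forall>\<^sub>F e in at_right 0. of_real e / (a + of_real e - 1) -
      of_real e * (deriv pole_free_zeta (a + of_real e) / pole_free_zeta (a + of_real e))
      = of_real e * mangoldt_series (a + of_real e)"
  proof eventually_elim
    case (elim e)
    then show ?case using assms by (subst mangoldt_series_eq) (auto simp: algebra_simps)
  qed
  show ?thesis by (rule that[OF m(1) Lim_transform_eventually[OF lim ev]])
qed

text \<open>Termwise this is \<open>3 + 4 cos \<theta> + cos 2\<theta> = 2 (1 + cos \<theta>)\<^sup>2 \<ge> 0\<close> with \<open>\<theta> = t log n\<close>.\<close>

lemma mangoldt_series_3_4_1:
  assumes "1 < Re s" and t: "t = Im s"
  shows "0 \<le> 3 * Re (mangoldt_series (of_real (Re s))) + 4 * Re (mangoldt_series s)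
      + Re (mangoldt_series (s + \<i> * t))"
proof -
  define r where "r = (\<lambda>n. mangoldt (Suc n) * real (Suc n) powr -Re s)"
  define \<theta> where "\<theta> = (\<lambda>n. t * ln (real (Suc n)))"
  have re_term: "Re (mangoldt (Suc n) * of_nat (Suc n) powr -z) = r n * cos (Im z * ln (real (Suc n)))"
    if "Re z = Re s" for n z
  proof -
    have "of_nat (Suc n) powr -z = exp (-z * of_real (ln (real (Suc n))))"
      by (simp add: powr_def Ln_of_nat del: of_nat_Suc)
    then have "Re (of_nat (Suc n) powr -z) = real (Suc n) powr -Re s * cos (Im z * ln (real (Suc n)))"
      using that by (simp add: Re_exp powr_def del: of_nat_Suc)
    moreover have "mangoldt (Suc n) = complex_of_real (mangoldt (Suc n))" by simp
    ultimately show ?thesis by (simp add: r_def del: of_real_mangoldt of_nat_Suc)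
  qed
  have S: "(\<lambda>n. r n * cos (Im z * ln (real (Suc n)))) sums Re (mangoldt_series z)" if "Re z = Re s" for z
    using sums_Re[OF mangoldt_sums[of z]] that assms re_term[OF that] by simp
  have sums: "(\<lambda>n. 3 * (r n * cos (0 * ln (real (Suc n)))) + 4 * (r n * cos (\<theta> n)) + r n * cos (2 * \<theta> n)) sums
     (3 * Re (mangoldt_series (of_real (Re s))) + 4 * Re (mangoldt_series s) + Re (mangoldt_series (s + \<i> * t)))"
  proof (intro sums_add sums_mult)
    show "(\<lambda>n. r n * cos (0 * ln (real (Suc n)))) sums Re (mangoldt_series (of_real (Re s)))"
      using S[of "of_real (Re s)"] unfolding Im_complex_of_real by simp
    show "(\<lambda>n. r n * cos (\<theta> n)) sums Re (mangoldt_series s)"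
      using S[of s] by (simp add: \<theta>_def t)
    have "Im (s + \<i> * t) * ln (real (Suc n)) = 2 * \<theta> n" for n by (simp add: \<theta>_def t)
    then show "(\<lambda>n. r n * cos (2 * \<theta> n)) sums Re (mangoldt_series (s + \<i> * t))"
      using S[of "s + \<i> * t"] by simp
  qed
  have nonneg: "0 \<le> 3 * (r n * cos (0 * ln (real (Suc n)))) + 4 * (r n * cos (\<theta> n)) + r n * cos (2 * \<theta> n)" for n
  proof -
    have "3 * (r n * cos (0 * ln (real (Suc n)))) + 4 * (r n * cos (\<theta> n)) + r n * cos (2 * \<theta> n)
        = r n * (2 * (1 + cos (\<theta> n))\<^sup>2)"
      unfolding cos_double_cos by (simp add: power2_eq_square algebra_simps)
    then show ?thesis by (simp add: r_def mangoldt_nonneg)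
  qed
  show ?thesis by (rule sums_le[OF nonneg sums_zero sums])
qed



text \<open>For s = 1 + it with t nonzero, multiplying the 3-4-1 inequality at s + e by e and
  letting e tend to 0 gives 0 <= 3 - 4m - k, where m and k are the orders at 1 + it and 1 + 2it.
  Hence m = 0, because 4 > 3.\<close>

theorem pole_free_zeta_nonzero:
  assumes "1 \<le> Re s" shows "pole_free_zeta s \<noteq> 0"
proof -
  obtain m :: nat where m: "m = 0 \<longleftrightarrow> pole_free_zeta s \<noteq> 0"
    "((\<lambda>e. of_real e * mangoldt_series (s + of_real e)) \<longlongrightarrow> (if s = 1 then 1 else 0) - of_nat m) (at_right 0)"
    using mangoldt_series_residue[OF assms] .
  have pos: "\<forall>\<^sub>F e in at_right (0::real). 0 < e" by (simp add: eventually_at_right_less)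
  consider "s = 1" | "1 < Re s" | "Re s = 1" "s \<noteq> 1" using assms by linarith
  then show ?thesis
  proof cases
    case 1 then show ?thesis by simp
  next
    case 2
    \<comment> \<open>To the right of the line the series of Lambda stays bounded by
      \<open>C\<close> near s, so its residue vanishes and m = 0.\<close>
    define C where "C = (\<Sum>n. ln (real (Suc n)) * real (Suc n) powr -Re s)"
    have "((\<lambda>e. of_real e * mangoldt_series (s + of_real e)) \<longlongrightarrow> 0) (at_right 0)"
    proof (rule Lim_null_comparison)
      show "((\<lambda>e. e * C) \<longlongrightarrow> 0) (at_right (0::real))"
        by (auto intro!: tendsto_eq_intros)
      show "\<forall>\<^sub>F e in at_right 0. norm (of_real e * mangoldt_series (s + of_real e)) \<le> e * C"
        using pos
      proof eventually_elim
        case (elim e)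
        have "norm (mangoldt_series (s + of_real e)) \<le> (\<Sum>n. ln (real (Suc n)) * real (Suc n) powr -Re (s + of_real e))"
          using elim 2 by (intro norm_mangoldt_series_le) auto
        also have "\<dots> \<le> C"
          unfolding C_def using elim 2
          by (intro suminf_le mult_left_mono powr_mono summable_ln_powr) auto
        finally show ?case using elim by (simp add: norm_mult mult_left_mono)
      qed
    qed
    then have "(if s = 1 then 1 else 0) - complex_of_nat m = 0"
      using tendsto_unique[OF _ m(2)] by simp
    moreover have "s \<noteq> 1" using 2 by auto
    ultimately show ?thesis using m(1) by simp
  next
    case 3
    define t where "t = Im s"
    have t: "t \<noteq> 0" using 3 by (auto simp: t_def complex_eq_iff)
    have "1 \<le> Re (s + \<i> * t)" using assms by simp
    from mangoldt_series_residue[OF this] obtain k :: nat where "k = 0 \<longleftrightarrow> pole_free_zeta (s + \<i> * t) \<noteq> 0" and k: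
      "((\<lambda>e. of_real e * mangoldt_series (s + \<i> * t + of_real e)) \<longlongrightarrow> (if s + \<i> * t = 1 then 1 else 0) - of_nat k) (at_right 0)"
      .
    have "1 \<le> Re 1" by simp
    from mangoldt_series_residue[OF this] obtain l :: nat where l: "l = 0 \<longleftrightarrow> pole_free_zeta 1 \<noteq> 0"
      "((\<lambda>e. of_real e * mangoldt_series (1 + of_real e)) \<longlongrightarrow> (if (1::complex) = 1 then 1 else 0) - of_nat l) (at_right 0)"
      .
    have st: "s + \<i> * t \<noteq> 1" using t 3 by (auto simp: complex_eq_iff t_def)
    have "((\<lambda>e. 3 * Re (of_real e * mangoldt_series (1 + of_real e)) + 4 * Re (of_real e * mangoldt_series (s + of_real e))
        + Re (of_real e * mangoldt_series (s + \<i> * t + of_real e))) \<longlongrightarrow>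
        3 * Re ((if (1::complex) = 1 then 1 else 0) - of_nat l) + 4 * Re ((if s = 1 then 1 else 0) - of_nat m)
        + Re ((if s + \<i> * t = 1 then 1 else 0) - of_nat k)) (at_right 0)"
      by (intro tendsto_intros m(2) k l(2))
    moreover have "\<forall>\<^sub>F e in at_right 0. 0 \<le> 3 * Re (of_real e * mangoldt_series (1 + of_real e)) + 4 * Re (of_real e * mangoldt_series (s + of_real e))
        + Re (of_real e * mangoldt_series (s + \<i> * t + of_real e))"
      using pos
    proof eventually_elim
      case (elim e)
      have "0 \<le> 3 * Re (mangoldt_series (of_real (Re (s + of_real e)))) + 4 * Re (mangoldt_series (s + of_real e))
          + Re (mangoldt_series (s + of_real e + \<i> * t))"
        using elim 3 by (intro mangoldt_series_3_4_1) (auto simp: t_def)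
      then have "0 \<le> e * (3 * Re (mangoldt_series (1 + of_real e)) + 4 * Re (mangoldt_series (s + of_real e))
          + Re (mangoldt_series (s + \<i> * t + of_real e)))"
        using elim 3 by (intro mult_nonneg_nonneg) (auto simp: algebra_simps)
      then show ?case by (simp add: algebra_simps)
    qed
    ultimately have "0 \<le> 3 * Re ((if (1::complex) = 1 then 1 else 0) - of_nat l) + 4 * Re ((if s = 1 then 1 else 0) - of_nat m)
        + Re ((if s + \<i> * t = 1 then 1 else 0) - of_nat k)"
      by (rule tendsto_lowerbound) simp
    then have "0 \<le> 3 - 4 * real m - real k" using st 3 l(1) by simp
    then have "m = 0" by linarith
    then show ?thesis using m(1) by simp
  qed
qed

section \<open>The prime number theorem\<close>

text \<open>The error of replacing \<open>n\<^sup>-\<^sup>s - (n+1)\<^sup>-\<^sup>s\<close> by \<open>s n\<^sup>-\<^sup>s\<^sup>-\<^sup>1\<close> in the Abel summation of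
  \<open>\<Sum> \<Lambda>(n) n\<^sup>-\<^sup>s\<close>; it extends to \<open>Re s > 0\<close>.\<close>

definition psi_term :: "nat \<Rightarrow> complex \<Rightarrow> complex" where
  "psi_term n s = of_real (chebyshev_psi (Suc n)) *
     (of_nat (Suc (Suc n)) powr -s - of_nat (Suc n) powr -s + s * of_nat (Suc n) powr (-s-1))"

definition psi_correction :: "complex \<Rightarrow> complex" where
  "psi_correction s = (\<Sum>n. psi_term n s)"

text \<open>The factor psi costs one power of n+1 and the Taylor estimate gains two; what remains is
  summable for Re s > 0.\<close>

lemma psi_term_bound:
  assumes "0 < Re s"
  shows "norm (psi_term n s) \<le> 6 * norm s * norm (s+1) * real (Suc n) powr (-1 - (Re s - 0))"
proof -
  have "norm (psi_term n s) \<le> (6 * real (Suc n)) * (norm s * norm (s+1) * real (Suc n) powr (-Re s - 2))"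
    unfolding psi_term_def norm_mult
    using powr_taylor_bound[of "Suc n" s] assms chebyshev_psi_le[of "Suc n"] chebyshev_psi_nonneg[of "Suc n"]
    by (intro mult_mono) (auto simp del: of_nat_Suc)
  also have "\<dots> = 6 * norm s * norm (s+1) * (real (Suc n) powr 1 * real (Suc n) powr (-Re s - 2))"
    by simp
  also have "real (Suc n) powr 1 * real (Suc n) powr (-Re s - 2) = real (Suc n) powr (-1 - (Re s - 0))"
    unfolding powr_add[symmetric] by simp
  finally show ?thesis .
qed

lemma
  shows psi_correction_holomorphic: "psi_correction holomorphic_on {s. 0 < Re s}"
    and psi_term_sums: "0 < Re s \<Longrightarrow> (\<lambda>n. psi_term n s) sums psi_correction s"
proof -
  have h: "psi_term n holomorphic_on A" for n A
    unfolding psi_term_def by (intro holomorphic_intros)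
  have c: "continuous_on UNIV (\<lambda>s::complex. 6 * norm s * norm (s+1))"
    by (intro continuous_intros)
  note * = holomorphic_Dirichlet[of psi_term 0, OF h psi_term_bound c]
  have eq: "psi_correction = (\<lambda>s. \<Sum>n. psi_term n s)" by (simp add: psi_correction_def fun_eq_iff)
  show "psi_correction holomorphic_on {s. 0 < Re s}" unfolding eq by (rule *(1))
  show "(\<lambda>n. psi_term n s) sums psi_correction s" if "0 < Re s" unfolding eq by (rule *(2)[OF _ that])
qed

lemma mangoldt_abel_summation:
  "(\<Sum>n<N. mangoldt (Suc n) * of_nat (Suc n) powr -s :: complex) =
   (\<Sum>n<N. of_real (chebyshev_psi (Suc n)) * (of_nat (Suc n) powr -s - of_nat (Suc (Suc n)) powr -s))
   + of_real (chebyshev_psi N) * of_nat (Suc N) powr -s"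
proof (induction N)
  case (Suc N)
  then show ?case
    by (simp add: chebyshev_psi_Suc[of N] algebra_simps del: of_nat_Suc)
qed simp

text \<open>Abel summation: the boundary term is O(N^(1 - Re s)), and \<open>psi_correction\<close>
  turns the differences of powers into s n^(-s-1).\<close>

lemma psi_Dirichlet_sums:
  assumes s: "1 < Re s"
  shows "(\<lambda>n. of_real (chebyshev_psi (Suc n)) * of_nat (Suc n) powr (-s-1)) sums
    ((mangoldt_series s + psi_correction s) / s)"
proof -
  have "(\<lambda>N. of_real (chebyshev_psi N) * of_nat (Suc N) powr -s :: complex) \<longlonglongrightarrow> 0"
  proof (rule Lim_null_comparison)
    show "\<forall>\<^sub>F N in sequentially. norm (of_real (chebyshev_psi N) * of_nat (Suc N) powr -s :: complex)
        \<le> 6 * real (Suc N) powr (1 - Re s)"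
    proof (intro always_eventually allI)
      fix N
      have "norm (of_real (chebyshev_psi N) * of_nat (Suc N) powr -s :: complex)
          \<le> 6 * real (Suc N) powr 1 * real (Suc N) powr -Re s"
        unfolding norm_mult norm_of_nat_powr
        using chebyshev_psi_le[of N] chebyshev_psi_nonneg[of N] by (intro mult_mono) auto
      also have "\<dots> = 6 * real (Suc N) powr (1 - Re s)"
        unfolding mult.assoc powr_add[symmetric] by simp
      finally show "norm (of_real (chebyshev_psi N) * of_nat (Suc N) powr -s :: complex)
        \<le> 6 * real (Suc N) powr (1 - Re s)" .
    qed
    have "(\<lambda>N. real (Suc N) powr (1 - Re s)) \<longlonglongrightarrow> 0"
      using s by (intro tendsto_neg_powr filterlim_compose[OF filterlim_real_sequentially filterlim_Suc]) auto
    from tendsto_mult_left[OF this, of 6] show "(\<lambda>N. 6 * real (Suc N) powr (1 - Re s)) \<longlonglongrightarrow> 0" by simp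
  qed
  from tendsto_diff[OF mangoldt_sums[OF s, unfolded sums_def mangoldt_abel_summation] this]
  have "(\<lambda>n. of_real (chebyshev_psi (Suc n)) * (of_nat (Suc n) powr -s - of_nat (Suc (Suc n)) powr -s))
      sums mangoldt_series s"
    by (simp add: sums_def)
  moreover have "0 < Re s" using s by simp
  ultimately have "(\<lambda>n. of_real (chebyshev_psi (Suc n)) * (of_nat (Suc n) powr -s - of_nat (Suc (Suc n)) powr -s)
      + psi_term n s) sums (mangoldt_series s + psi_correction s)"
    by (intro sums_add psi_term_sums)
  then have sm: "(\<lambda>n. s * (of_real (chebyshev_psi (Suc n)) * of_nat (Suc n) powr (-s-1))) sums
    (mangoldt_series s + psi_correction s)"
    by (simp add: psi_term_def algebra_simps del: of_nat_Suc)
  have "s \<noteq> 0" using s by auto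
  with sums_divide[OF sm, of s] show ?thesis by (simp del: of_nat_Suc)
qed

text \<open>Newman's theorem at s = 1 with coefficients psi(n)/n - 1. For Re s > 1 their series is
  (\<open>mangoldt_series\<close> + \<open>psi_correction\<close>)/s - zeta, and both poles at 1
  have residue 1.\<close>

lemma summable_psi_minus_id:
  "summable (\<lambda>n. (chebyshev_psi n - real n) / (real n)\<^sup>2)"
proof -
  \<comment> \<open>Removing the zeros of (s-1) zeta(s) leaves an open set that still contains Re s
    >= 1, by non-vanishing on that closed half-plane.\<close>
  define U where "U = {s. 0 < Re s} \<inter> pole_free_zeta -` (-{0})"
  define a where "a = (\<lambda>n. complex_of_real (chebyshev_psi (Suc n) / real (Suc n) - 1))"
  \<comment> \<open>The regular part of zeta: zeta(s) = 1/(s-1) + Q(s), since (s-1) zeta(s) equals 1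
    at s = 1.\<close>
  define Q where "Q = (\<lambda>s. if s = 1 then deriv pole_free_zeta 1 else (pole_free_zeta s - pole_free_zeta 1) / (s - 1))"
  \<comment> \<open>What is left after 1/(s(s-1)) = 1/(s-1) - 1/s has cancelled the pole of
    zeta.\<close>
  define f where "f = (\<lambda>s. psi_correction s / s - 1 / s - Q s - deriv pole_free_zeta s / (s * pole_free_zeta s))"
  have op: "open {s::complex. 0 < Re s}" by (rule open_halfspace_Re_gt)
  have U: "open U"
    unfolding U_def
    by (rule continuous_open_preimage[OF holomorphic_on_imp_continuous_on[OF pole_free_zeta_holomorphic] op]) auto
  have U1: "{s. 1 \<le> Re s} \<subseteq> U" unfolding U_def using pole_free_zeta_nonzero by auto
  have "Q holomorphic_on {s. 0 < Re s}"
    unfolding Q_def by (rule pole_lemma_open[OF pole_free_zeta_holomorphic op])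
  moreover have "U \<subseteq> {s. 0 < Re s}" by (auto simp: U_def)
  ultimately have hol: "Q holomorphic_on U" "psi_correction holomorphic_on U" "pole_free_zeta holomorphic_on U"
      "deriv pole_free_zeta holomorphic_on U"
    using psi_correction_holomorphic pole_free_zeta_holomorphic holomorphic_deriv[OF pole_free_zeta_holomorphic op]
    by (simp_all add: holomorphic_on_subset)
  have f: "f holomorphic_on U"
    unfolding f_def by (intro holomorphic_intros hol) (auto simp: U_def)
  have "(\<lambda>n. a n / of_nat (Suc n)) sums f 1"
  proof (rule Newman_tauberian[OF _ U U1 f])
    fix n
    have "chebyshev_psi (Suc n) / real (Suc n) \<le> 6"
      using chebyshev_psi_le[of "Suc n"] by (simp add: field_simps)
    moreover have "0 \<le> chebyshev_psi (Suc n) / real (Suc n)"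
      using chebyshev_psi_nonneg[of "Suc n"] by simp
    ultimately show "norm (a n) \<le> 6" unfolding a_def norm_of_real by simp
  next
    fix s :: complex assume s: "1 < Re s"
    then have s0: "s \<noteq> 0" "s \<noteq> 1" by auto
    have Z: "pole_free_zeta s \<noteq> 0" using pole_free_zeta_nonzero[of s] s by simp
    have "(mangoldt_series s + psi_correction s) / s - zeta s
        = (1/(s-1) - deriv pole_free_zeta s / pole_free_zeta s + psi_correction s) / s - pole_free_zeta s / (s-1)"
      using mangoldt_series_eq[OF s Z] pole_free_zeta_eq[OF s] s0 by simp
    also have "\<dots> = (1 / (s * (s-1)) - pole_free_zeta s / (s-1)) + psi_correction s / s
        - deriv pole_free_zeta s / (s * pole_free_zeta s)"
      by (simp add: add_divide_distrib diff_divide_distrib mult.commute)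
    also have "1 / (s * (s-1)) = 1/(s-1) - 1/s" using s0 by (simp add: field_simps)
    also have "1/(s-1) - 1/s - pole_free_zeta s / (s-1) + psi_correction s / s
        - deriv pole_free_zeta s / (s * pole_free_zeta s) = f s"
      using s0 by (simp add: f_def Q_def diff_divide_distrib)
    finally have fs: "f s = (mangoldt_series s + psi_correction s) / s - zeta s" by simp
    have "a n * of_nat (Suc n) powr -s = of_real (chebyshev_psi (Suc n)) * of_nat (Suc n) powr (-s-1)
        - of_nat (Suc n) powr -s" for n
      by (simp add: a_def powr_diff ring_distribs del: of_nat_Suc)
    then show "(\<lambda>n. a n * of_nat (Suc n) powr -s) sums f s"
      unfolding fs using sums_diff[OF psi_Dirichlet_sums[OF s] zeta_sums[OF s]] by simp
  qed
  from sums_summable[OF sums_Re[OF this]]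
  have sm: "summable (\<lambda>n. Re (a n / of_nat (Suc n)))" .
  have eq: "Re (a n / of_nat (Suc n)) = (chebyshev_psi (Suc n) - real (Suc n)) / (real (Suc n))\<^sup>2" for n
  proof -
    have "Re (a n / of_nat (Suc n)) = (chebyshev_psi (Suc n) / real (Suc n) - 1) / real (Suc n)"
      unfolding a_def by (simp add: Re_divide_of_nat del: of_nat_Suc)
    then show ?thesis
      by (simp add: power2_eq_square diff_divide_distrib del: of_nat_Suc)
  qed
  have "summable (\<lambda>n. (chebyshev_psi (Suc n) - real (Suc n)) / (real (Suc n))\<^sup>2)"
    using sm unfolding eq .
  then show ?thesis
    by (rule iffD1[OF summable_Suc_iff[of "\<lambda>n. (chebyshev_psi n - real n) / (real n)\<^sup>2"]])
qed

text \<open>Since \<open>\<psi>\<close> is increasing, a deviation of \<open>\<psi> m / m\<close> from 1 by \<open>2e\<close> persists at size \<open>e\<close> over a range of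
  length \<open>e m\<close>, on which the series contributes at least \<open>e\<^sup>2/4\<close>.\<close>

theorem chebyshev_psi_asymptotics: "(\<lambda>n. chebyshev_psi n / real n) \<longlonglongrightarrow> 1"
proof (rule tendstoI)
  fix \<epsilon> :: real assume \<epsilon>: "0 < \<epsilon>"
  \<comment> \<open>A third of \<epsilon> makes 2e < \<epsilon> strict; the cap 1/2 keeps n <= 2m in
    the range above m and l >= m/2 in the range below it.\<close>
  define e where "e = min (1/2) (\<epsilon>/3)"
  have e: "0 < e" "e \<le> 1/2" "2 * e < \<epsilon>" using \<epsilon> by (auto simp: e_def)
  define b where "b = (\<lambda>n. (chebyshev_psi n - real n) / (real n)\<^sup>2)"
  obtain N where N: "\<And>m n. N \<le> m \<Longrightarrow> norm (sum b {m..<n}) < e\<^sup>2/4"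
    using summable_psi_minus_id[folded b_def] e(1) unfolding summable_Cauchy by (meson zero_less_power divide_pos_pos zero_less_numeral)
  have "\<bar>chebyshev_psi m / real m - 1\<bar> < 2 * e" if m: "2 * N \<le> m" "2 / e \<le> real m" for m
  proof -
    have m0: "0 < real m" using m e by (smt (verit) divide_pos_pos)
    \<comment> \<open>Lets the rounding in \<open>l\<close> cost at most half of its range: e m - 1
      >= e m / 2.\<close>
    have em: "2 \<le> e * real m" using m(2) e(1) by (simp add: field_simps)
    have "chebyshev_psi m < (1 + 2 * e) * real m"
    proof (rule ccontr)
      assume "\<not> ?thesis"
      then have big: "(1 + 2 * e) * real m \<le> chebyshev_psi m" by simp
      \<comment> \<open>An excess at m persists upwards: for n <= (1+e)m still psi(n) - n >= e m,
        while n^2 <= 4m^2, so about e m terms of size e/(4m) appear.\<close>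
      define k where "k = nat \<lceil>e * real m\<rceil>"
      have k: "e * real m \<le> real k" "real k < e * real m + 1" using em by (auto simp: k_def) linarith+
      have "b n \<ge> e / (4 * real m)" if n: "n \<in> {m..<m+k}" for n
      proof -
        have n1: "real m \<le> real n" "real n \<le> real m + e * real m" using n k by auto
        have "e * real m \<le> chebyshev_psi m - real n" using big n1 by (simp add: algebra_simps)
        also have "\<dots> \<le> chebyshev_psi n - real n" using chebyshev_psi_mono[of m n] n by simp
        finally have num: "e * real m \<le> chebyshev_psi n - real n" .
        have "e * real m \<le> 1 * real m" using e m0 by (intro mult_right_mono) auto
        then have "(real n)\<^sup>2 \<le> (2 * real m)\<^sup>2" using n1 by (intro power_mono) auto
        then have "e * real m / (2 * real m)\<^sup>2 \<le> b n"
          unfolding b_def using num e m0 n1 by (intro frac_le) auto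
        then show ?thesis using m0 by (simp add: power2_eq_square)
      qed
      then have "real (card {m..<m+k}) * (e / (4 * real m)) \<le> sum b {m..<m+k}" by (intro sum_bounded_below)
      moreover have "e * real m * (e / (4 * real m)) \<le> real k * (e / (4 * real m))"
        using k e m0 by (intro mult_right_mono) auto
      moreover have "e * real m * (e / (4 * real m)) = e\<^sup>2/4" using m0 by (simp add: power2_eq_square)
      ultimately have "e\<^sup>2/4 \<le> sum b {m..<m+k}" by simp
      moreover have "norm (sum b {m..<m+k}) < e\<^sup>2/4" using m by (intro N) auto
      ultimately show False by simp
    qed
    moreover have "(1 - 2 * e) * real m < chebyshev_psi m"
    proof (rule ccontr)
      assume "\<not> ?thesis"
      then have small: "chebyshev_psi m \<le> (1 - 2 * e) * real m" by simp
      \<comment> \<open>A deficit persists downwards, as psi(n) <= psi(m) for n <= m. The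
        requirement m >= 2N keeps this range in the Cauchy tail.\<close>
      define l where "l = nat \<lceil>(1 - e) * real m\<rceil>"
      have "0 \<le> (1 - e) * real m" using e m0 by simp
      then have l: "(1 - e) * real m \<le> real l" "real l < (1 - e) * real m + 1" by (auto simp: l_def) linarith+
      have lm: "real l \<le> real m" using l em by (simp add: algebra_simps)
      have "(1/2) * real m \<le> (1 - e) * real m" using e m0 by (intro mult_right_mono) auto
      then have lN: "N \<le> l" using l m by linarith
      have l0: "0 < real l" using \<open>(1/2) * real m \<le> (1 - e) * real m\<close> l m0 by linarith
      have "b n \<le> - (e / real m)" if n: "n \<in> {l..<m}" for n
      proof -
        have n1: "real l \<le> real n" "real n \<le> real m" using n by auto
        have "chebyshev_psi n - real n \<le> chebyshev_psi m - real l"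
          using chebyshev_psi_mono[of n m] n by simp
        also have "\<dots> \<le> - (e * real m)" using small l by (simp add: algebra_simps)
        finally have num: "e * real m \<le> real n - chebyshev_psi n" by simp
        have "(real n)\<^sup>2 \<le> (real m)\<^sup>2" using n1 by (intro power_mono) auto
        moreover have "0 \<le> real n - chebyshev_psi n"
          by (rule order_trans[OF _ num]) (use e m0 in simp)
        ultimately have "e * real m / (real m)\<^sup>2 \<le> (real n - chebyshev_psi n) / (real n)\<^sup>2"
          using num e m0 n1 l0 by (intro frac_le) auto
        also have "\<dots> = - b n" by (simp add: b_def minus_divide_left)
        finally show ?thesis using m0 by (simp add: power2_eq_square)
      qed
      then have "sum b {l..<m} \<le> real (card {l..<m}) * - (e / real m)" by (intro sum_bounded_above)
      moreover have "real (card {l..<m}) = real m - real l" using lm by (simp add: of_nat_diff)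
      moreover have "e * real m / 2 \<le> real m - real l" using l em by (simp add: algebra_simps)
      then have "e * real m / 2 * (e / real m) \<le> (real m - real l) * (e / real m)"
        using e m0 by (intro mult_right_mono) auto
      moreover have "e * real m / 2 * (e / real m) = e\<^sup>2/2" using m0 by (simp add: power2_eq_square)
      ultimately have "sum b {l..<m} \<le> - (e\<^sup>2/2)" by simp
      moreover have "norm (sum b {l..<m}) < e\<^sup>2/4" using lN by (intro N)
      moreover have "0 < e\<^sup>2" using e by simp
      ultimately show False by (simp add: abs_if split: if_splits)
    qed
    ultimately have "1 - 2 * e < chebyshev_psi m / real m" "chebyshev_psi m / real m < 1 + 2 * e"
      using m0 by (simp_all add: field_simps)
    then show ?thesis by linarith
  qed
  note bound = this
  have "\<forall>\<^sub>F m in sequentially. 2 / e \<le> real m"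
    using filterlim_real_sequentially by (simp add: filterlim_at_top)
  then show "\<forall>\<^sub>F m in sequentially. dist (chebyshev_psi m / real m) 1 < \<epsilon>"
    using eventually_ge_at_top[of "2 * N"]
  proof eventually_elim
    case (elim m)
    show ?case unfolding dist_real_def by (rule less_trans[OF bound[OF elim(2,1)] e(3)])
  qed
qed

section \<open>From psi to theta and to the number of primes\<close>

definition chebyshev_theta :: "nat \<Rightarrow> real" where
  "chebyshev_theta N = (\<Sum>k=1..N. mangoldt' k)"

lemma chebyshev_theta_eq: "chebyshev_theta N = (\<Sum>p | prime p \<and> p \<le> N. ln (real p))"
proof -
  have "chebyshev_theta N = (\<Sum>k\<in>{1..N}. if prime k then ln (real k) else 0)"
    unfolding chebyshev_theta_def by (intro sum.cong) (auto simp: mangoldt'_def)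
  also have "\<dots> = (\<Sum>p\<in>{p\<in>{1..N}. prime p}. ln (real p))"
    by (rule sum.inter_filter[symmetric]) simp
  also have "{p\<in>{1..N}. prime p} = {p. prime p \<and> p \<le> N}"
    by (auto simp: Suc_le_eq prime_gt_0_nat)
  finally show ?thesis .
qed

lemma mangoldt'_le_mangoldt: "mangoldt' n \<le> mangoldt n"
  using mangoldt_nonneg[of n] by (simp add: mangoldt'_def indicator_def)

text \<open>A proper prime power p^j <= N has p <= sqrt N and j <= log_2 N, and each contributes at
  most log N. The 1 comes from letting j start at 0.\<close>

lemma psi_minus_theta_bound:
  assumes "1 \<le> N"
  shows "(\<Sum>k=1..N. mangoldt k - mangoldt' k) \<le> sqrt N * (log 2 N + 1) * ln N"
proof -
  define A where "A = {k\<in>{1..N}. primepow k \<and> \<not> prime k}"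
  define P where "P = {1..nat \<lfloor>sqrt N\<rfloor>}"
  define J where "J = {0..nat \<lfloor>log 2 N\<rfloor>}"
  have lN: "0 \<le> ln (real N)" "0 \<le> log 2 (real N)" using assms by (auto simp: zero_le_log_cancel_iff)
  have "(\<Sum>k=1..N. mangoldt k - mangoldt' k) = (\<Sum>k\<in>A. mangoldt k)"
  proof (rule sum.mono_neutral_cong_right)
    show "\<forall>k\<in>{1..N} - A. mangoldt k - mangoldt' k = 0"
      by (auto simp: A_def mangoldt'_def mangoldt_def[of k for k] indicator_def)
  qed (auto simp: A_def mangoldt'_def)
  also have "\<dots> \<le> real (card A) * ln N"
  proof (rule sum_bounded_above)
    fix k assume "k \<in> A"
    then show "mangoldt k \<le> ln (real N)"
      using mangoldt_le[of k] by (auto simp: A_def intro: order_trans)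
  qed
  also have "card A \<le> card ((\<lambda>(p,j). p ^ j) ` (P \<times> J))"
  proof (intro card_mono subsetI)
    fix k assume k: "k \<in> A"
    then obtain p j where pj: "prime p" "0 < j" "k = p ^ j" by (auto simp: A_def primepow_def)
    have p2: "2 \<le> p" using pj by (simp add: prime_ge_2_nat)
    have "j \<noteq> 1" using k pj by (auto simp: A_def)
    then have "p ^ 2 \<le> p ^ j" using pj p2 by (intro power_increasing) auto
    also have "\<dots> \<le> N" using k pj by (auto simp: A_def)
    finally have "(real p)\<^sup>2 \<le> real N" by (metis of_nat_le_iff of_nat_power)
    then have "real p \<le> sqrt N" by (rule real_le_rsqrt)
    then have pP: "p \<in> P" using p2 by (auto simp: P_def le_nat_floor)
    have "2 ^ j \<le> p ^ j" using p2 by (intro power_mono) auto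
    also have "\<dots> \<le> N" using k pj by (auto simp: A_def)
    finally have "real j \<le> log 2 N" using le_log2_of_power by blast
    then have "j \<in> J" by (auto simp: J_def le_nat_floor)
    with pP pj show "k \<in> (\<lambda>(p,j). p ^ j) ` (P \<times> J)" by auto
  qed (auto simp: P_def J_def)
  also have "\<dots> \<le> card (P \<times> J)" by (intro card_image_le) (auto simp: P_def J_def)
  also have "real (card (P \<times> J)) \<le> sqrt N * (log 2 N + 1)"
  proof -
    have "real (card P) \<le> sqrt N" "real (card J) \<le> log 2 N + 1"
      using lN by (simp_all add: P_def J_def)
    then show ?thesis
      unfolding card_cartesian_product of_nat_mult by (intro mult_mono) auto
  qed
  finally show ?thesis using lN by (simp add: mult_right_mono)
qed

lemma psi_minus_theta_limit: "(\<lambda>N. (\<Sum>k=1..N. mangoldt k - mangoldt' k) / real N) \<longlonglongrightarrow> 0"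
proof (rule tendsto_sandwich)
  show "\<forall>\<^sub>F N in sequentially. 0 \<le> (\<Sum>k=1..N. mangoldt k - mangoldt' k) / real N"
    using mangoldt'_le_mangoldt by (intro always_eventually allI divide_nonneg_nonneg sum_nonneg) auto
  show "\<forall>\<^sub>F N in sequentially. (\<Sum>k=1..N. mangoldt k - mangoldt' k) / real N
      \<le> sqrt N * (log 2 N + 1) * ln N / real N"
    using eventually_ge_at_top[of 1]
    by eventually_elim (intro divide_right_mono psi_minus_theta_bound, auto)
  show "(\<lambda>N. sqrt N * (log 2 N + 1) * ln N / real N) \<longlonglongrightarrow> 0" by real_asymp
qed simp

lemma chebyshev_theta_asymptotics: "(\<lambda>N. chebyshev_theta N / real N) \<longlonglongrightarrow> 1"
proof -
  have "chebyshev_theta N / real N = chebyshev_psi N / real N - (\<Sum>k=1..N. mangoldt k - mangoldt' k) / real N" for N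
    by (simp add: chebyshev_theta_def chebyshev_psi_def sum_subtractf diff_divide_distrib)
  then show ?thesis
    using tendsto_diff[OF chebyshev_psi_asymptotics psi_minus_theta_limit] by simp
qed

lemma finite_primes_le: "finite {p::nat. prime p \<and> p \<le> N}"
  by (rule finite_subset[of _ "{..N}"]) auto

lemma chebyshev_theta_le: "chebyshev_theta N \<le> real (prime_count N) * ln N"
  unfolding chebyshev_theta_eq prime_count_def
proof (rule sum_bounded_above)
  fix p assume "p \<in> {p. prime p \<and> p \<le> N}"
  then have "0 < p" "p \<le> N" by (auto simp: prime_gt_0_nat)
  then show "ln (real p) \<le> ln (real N)" by simp
qed

text \<open>At most y primes lie below y, and each prime beyond y adds at least log y to
  theta.\<close>

lemma prime_count_le:
  assumes "1 < y" "y \<le> real N"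
  shows "real (prime_count N) \<le> y + chebyshev_theta N / ln y"
proof -
  define A where "A = {p. prime p \<and> p \<le> N \<and> real p \<le> y}"
  define B where "B = {p. prime p \<and> p \<le> N \<and> y < real p}"
  have fin: "finite A" "finite B" by (auto simp: A_def B_def intro: finite_subset[OF _ finite_primes_le[of N]])
  have AB: "{p. prime p \<and> p \<le> N} = A \<union> B" "A \<inter> B = {}" by (auto simp: A_def B_def)
  have "A \<subseteq> {1..nat \<lfloor>y\<rfloor>}" by (auto simp: A_def le_nat_floor Suc_le_eq prime_gt_0_nat)
  then have "card A \<le> card {1..nat \<lfloor>y\<rfloor>}" by (intro card_mono) auto
  then have A: "real (card A) \<le> y" using assms by simp linarith
  have "real (card B) * ln y \<le> (\<Sum>p\<in>B. ln (real p))"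
    using assms by (intro sum_bounded_below) (auto simp: B_def)
  also have "\<dots> \<le> chebyshev_theta N"
    unfolding chebyshev_theta_eq AB(1) using fin
    by (intro sum_mono2) (auto simp: A_def B_def prime_gt_0_nat Suc_le_eq)
  finally have "real (card B) \<le> chebyshev_theta N / ln y"
    using assms by (simp add: field_simps)
  moreover have "prime_count N = card A + card B"
    unfolding prime_count_def AB(1) by (rule card_Un_disjoint[OF fin AB(2)])
  ultimately show ?thesis using A by simp
qed

theorem prime_number_theorem: "(\<lambda>N. real (prime_count N) * ln N / real N) \<longlonglongrightarrow> 1"
proof (rule tendsto_sandwich)
  show "\<forall>\<^sub>F N in sequentially. chebyshev_theta N / real N \<le> real (prime_count N) * ln N / real N"
    by (intro always_eventually allI divide_right_mono chebyshev_theta_le) auto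
  show "(\<lambda>N. chebyshev_theta N / real N) \<longlonglongrightarrow> 1" by (rule chebyshev_theta_asymptotics)
  \<comment> \<open>The cut y = N/(log N)^2 is small enough that y log N = o(N), yet log y is
    asymptotic to log N.\<close>
  have "\<forall>\<^sub>F N in sequentially. 1 < real N / (ln N)\<^sup>2" by real_asymp
  moreover have "\<forall>\<^sub>F N in sequentially. real N / (ln N)\<^sup>2 \<le> real N" by real_asymp
  moreover have "\<forall>\<^sub>F N in sequentially. 0 < ln (real N)" by real_asymp
  moreover have "\<forall>\<^sub>F N in sequentially. 0 < real N" by real_asymp
  ultimately show "\<forall>\<^sub>F N in sequentially. real (prime_count N) * ln N / real N \<le>
      1 / ln N + chebyshev_theta N / real N * (ln N / ln (real N / (ln N)\<^sup>2))"
  proof eventually_elim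
    case (elim N)
    have "real (prime_count N) * ln N / real N
        \<le> (real N / (ln N)\<^sup>2 + chebyshev_theta N / ln (real N / (ln N)\<^sup>2)) * ln N / real N"
      using elim by (intro divide_right_mono mult_right_mono prime_count_le) auto
    also have "\<dots> = 1 / ln N + chebyshev_theta N / real N * (ln N / ln (real N / (ln N)\<^sup>2))"
      using elim by (simp add: field_simps power2_eq_square)
    finally show ?case .
  qed
  have "(\<lambda>N. 1 / ln (real N)) \<longlonglongrightarrow> 0" "(\<lambda>N. ln (real N) / ln (real N / (ln N)\<^sup>2)) \<longlonglongrightarrow> 1"
    by real_asymp+
  from tendsto_add[OF this(1) tendsto_mult[OF chebyshev_theta_asymptotics this(2)]]
  show "(\<lambda>N. 1 / ln N + chebyshev_theta N / real N * (ln N / ln (real N / (ln N)\<^sup>2))) \<longlonglongrightarrow> 1"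
    by simp
qed

section \<open>Averages along the primes\<close>

lemma nth_prime_less_iff: "1 \<le> i \<Longrightarrow> 1 \<le> j \<Longrightarrow> nth_prime i < nth_prime j \<longleftrightarrow> i < j"
  using strict_mono_on_less[OF strict_mono_on_nth_prime] by simp

lemma inj_on_nth_prime: "inj_on nth_prime {1..}"
  using strict_mono_on_imp_inj_on[OF strict_mono_on_nth_prime] .

lemma nth_prime_image_atMost:
  assumes "1 \<le> n" shows "nth_prime ` {1..n} = {p. prime p \<and> p \<le> nth_prime n}"
proof (intro set_eqI iffI)
  fix p assume "p \<in> nth_prime ` {1..n}"
  then obtain i where i: "1 \<le> i" "i \<le> n" "p = nth_prime i" by auto
  then have "\<not> nth_prime n < nth_prime i" using nth_prime_less_iff[of n i] assms by simp
  moreover have "prime p" using nth_prime_image i by auto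
  ultimately show "p \<in> {p. prime p \<and> p \<le> nth_prime n}" using i by simp
next
  fix p assume p: "p \<in> {p. prime p \<and> p \<le> nth_prime n}"
  then have "p \<in> nth_prime ` {1..}" using nth_prime_image by auto
  then obtain i where i: "1 \<le> i" "p = nth_prime i" by auto
  then have "\<not> nth_prime n < nth_prime i" using p by simp
  then have "i \<le> n" using nth_prime_less_iff[of n i] assms i by simp
  then show "p \<in> nth_prime ` {1..n}" using i by auto
qed

lemma prime_count_nth_prime: "1 \<le> n \<Longrightarrow> prime_count (nth_prime n) = n"
  using card_image[OF inj_on_subset[OF inj_on_nth_prime], of "{1..n}"]
  by (simp add: prime_count_def nth_prime_image_atMost[symmetric])

text \<open>No prime lies strictly between the largest prime q <= N and N, so N may be replaced by
  q, whose index is known.\<close>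

lemma nth_prime_image_prime_count: "nth_prime ` {1..prime_count N} = {p. prime p \<and> p \<le> N}"
proof (cases "{p. prime p \<and> p \<le> N} = {}")
  case True
  then show ?thesis by (simp add: prime_count_def)
next
  case False
  define q where "q = Max {p. prime p \<and> p \<le> N}"
  have q: "prime q" "q \<le> N" "\<And>p. prime p \<Longrightarrow> p \<le> N \<Longrightarrow> p \<le> q"
    using Max_in[OF finite_primes_le False] Max_ge[OF finite_primes_le] by (auto simp: q_def)
  obtain n where n: "1 \<le> n" "q = nth_prime n" using q(1) nth_prime_image by auto
  have "{p. prime p \<and> p \<le> N} = {p. prime p \<and> p \<le> nth_prime n}" using q n by auto
  then show ?thesis
    using prime_count_nth_prime[OF n(1)] nth_prime_image_atMost[OF n(1)]
    by (simp add: prime_count_def)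
qed

lemma sum_nth_prime:
  "(\<Sum>j=1..prime_count N. f (nth_prime j)) = (\<Sum>p | prime p \<and> p \<le> N. f p)"
  unfolding nth_prime_image_prime_count[symmetric]
  by (subst sum.reindex) (auto intro: inj_on_subset[OF inj_on_nth_prime])

lemma log_prime_average_eq: "log_prime_average T x N = weighted_average mangoldt' T x N"
proof -
  have "(\<Sum>k=1..N. mangoldt' k *\<^sub>R (T ^^ k) x) = (\<Sum>k\<in>{1..N}. if prime k then ln (real k) *\<^sub>R (T ^^ k) x else 0)"
    by (intro sum.cong) (auto simp: mangoldt'_def)
  also have "\<dots> = (\<Sum>p\<in>{p\<in>{1..N}. prime p}. ln (real p) *\<^sub>R (T ^^ p) x)"
    by (rule sum.inter_filter[symmetric]) simp
  also have "{p\<in>{1..N}. prime p} = {p. prime p \<and> p \<le> N}"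
    by (auto simp: Suc_le_eq prime_gt_0_nat)
  finally show ?thesis
    unfolding log_prime_average_def weighted_average_def
    using sum_nth_prime[of "\<lambda>p. ln (real p) *\<^sub>R (T ^^ p) x" N] by simp
qed

section \<open>Comparison of the averages on a bounded orbit\<close>

lemma power_bounded_orbit_bounded:
  assumes "power_bounded T"
  obtains M where "\<And>n. norm ((T ^^ n) x) \<le> M"
proof -
  have bl: "bounded_linear (T ^^ n)" for n
  proof (induction n)
    case (Suc n)
    then show ?case
      using assms bounded_linear_compose[of T "T ^^ n"] by (simp add: power_bounded_def o_def)
  qed (simp add: id_def)
  obtain K where K: "\<And>n. onorm (T ^^ n) \<le> K"
    using assms by (auto simp: power_bounded_def bdd_above_def)
  have "norm ((T ^^ n) x) \<le> K * norm x" for n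
    using onorm[OF bl, of n x] K[of n] by (meson mult_right_mono norm_ge_zero order_trans)
  then show ?thesis by (rule that)
qed

lemma norm_average_le:
  fixes f :: "nat \<Rightarrow> 'a::real_normed_vector"
  assumes "\<And>n. norm (f n) \<le> M"
  shows "norm ((1 / real n) *\<^sub>R (\<Sum>k=1..n. f k)) \<le> M"
proof (cases "n = 0")
  case True
  then show ?thesis using order_trans[OF norm_ge_zero assms[of 0]] by simp
next
  case False
  have "norm (\<Sum>k=1..n. f k) \<le> real n * M"
    using sum_norm_bound[of "{1..n}" f M] assms by simp
  then show ?thesis using False by (simp add: field_simps)
qed

text \<open>The weight differences are nonnegative, so the norm is at most M times their scalar
  average, which tends to 0.\<close>

lemma mangoldt_averages_diff:
  assumes "power_bounded T"
  shows "(\<lambda>N. weighted_average mangoldt T x N - weighted_average mangoldt' T x N) \<longlonglongrightarrow> 0"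
proof -
  obtain M where M: "\<And>n. norm ((T ^^ n) x) \<le> M" using power_bounded_orbit_bounded[OF assms, of x] by blast
  show ?thesis
  proof (rule Lim_null_comparison[OF always_eventually], intro allI)
    fix N
    have "weighted_average mangoldt T x N - weighted_average mangoldt' T x N
        = (1 / real N) *\<^sub>R (\<Sum>k=1..N. (mangoldt k - mangoldt' k) *\<^sub>R (T ^^ k) x)"
      by (simp add: weighted_average_def scaleR_left_diff_distrib sum_subtractf scaleR_right_diff_distrib)
    also have "norm \<dots> \<le> (1 / real N) * (\<Sum>k=1..N. (mangoldt k - mangoldt' k) * M)"
      unfolding norm_scaleR
    proof (intro mult_mono sum_norm_le)
      fix k show "norm ((mangoldt k - mangoldt' k) *\<^sub>R (T ^^ k) x) \<le> (mangoldt k - mangoldt' k) * M"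
        using mangoldt'_le_mangoldt[of k] M[of k] by (simp add: mult_left_mono)
    qed auto
    finally show "norm (weighted_average mangoldt T x N - weighted_average mangoldt' T x N)
        \<le> (\<Sum>k=1..N. mangoldt k - mangoldt' k) / real N * M"
      by (simp add: sum_distrib_right)
  next
    show "(\<lambda>N. (\<Sum>k=1..N. mangoldt k - mangoldt' k) / real N * M) \<longlonglongrightarrow> 0"
      using tendsto_mult_right[OF psi_minus_theta_limit, of M] by simp
  qed
qed

text \<open>Rescaling the prime average by \<open>c N\<close> gives every prime the weight log N /
  N. The rescaling costs at most |1 - c N| M, and the weight differences log(N/p)/N add up to c N -
  theta(N)/N; both tend to 0.\<close>

lemma prime_averages_diff:
  assumes "power_bounded T"
  shows "(\<lambda>N. prime_average T x (prime_count N) - log_prime_average T x N) \<longlonglongrightarrow> 0"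
proof -
  obtain M where M: "\<And>n. norm ((T ^^ n) x) \<le> M" using power_bounded_orbit_bounded[OF assms, of x] by blast
  define c where "c = (\<lambda>N. real (prime_count N) * ln N / real N)"
  have c: "c \<longlonglongrightarrow> 1" unfolding c_def by (rule prime_number_theorem)
  have "norm (prime_average T x (prime_count N) - log_prime_average T x N)
      \<le> \<bar>1 - c N\<bar> * M + (c N - chebyshev_theta N / real N) * M" for N
  proof -
    let ?P = "{p. prime p \<and> p \<le> N}" and ?A = "prime_average T x (prime_count N)"
    \<comment> \<open>Without primes up to N the division by 0 in \<open>prime_average\<close>
      yields 0, and the prime sum is empty as well.\<close>
    have P0: "prime_count N = 0 \<Longrightarrow> ?P = {}" using finite_primes_le[of N] by (simp add: prime_count_def)
    have "c N *\<^sub>R ?A = (ln N / real N) *\<^sub>R (\<Sum>p\<in>?P. (T ^^ p) x)"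
      using P0 sum_nth_prime[of "\<lambda>p. (T ^^ p) x" N]
      by (cases "prime_count N = 0") (auto simp: prime_average_def c_def)
    moreover have "log_prime_average T x N = (1 / real N) *\<^sub>R (\<Sum>p\<in>?P. ln (real p) *\<^sub>R (T ^^ p) x)"
      unfolding log_prime_average_def using sum_nth_prime[of "\<lambda>p. ln (real p) *\<^sub>R (T ^^ p) x" N] by simp
    ultimately have "c N *\<^sub>R ?A - log_prime_average T x N
        = (1 / real N) *\<^sub>R (\<Sum>p\<in>?P. (ln N - ln (real p)) *\<^sub>R (T ^^ p) x)"
      by (simp add: scaleR_left_diff_distrib sum_subtractf scaleR_right_diff_distrib scaleR_sum_right)
    also have "norm \<dots> \<le> (1 / real N) * (\<Sum>p\<in>?P. (ln N - ln (real p)) * M)"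
      unfolding norm_scaleR
    proof (intro mult_mono sum_norm_le)
      fix p assume "p \<in> ?P"
      then have "0 < p" "p \<le> N" by (auto simp: prime_gt_0_nat)
      then have "0 \<le> ln N - ln (real p)" by simp
      then show "norm ((ln N - ln (real p)) *\<^sub>R (T ^^ p) x) \<le> (ln N - ln (real p)) * M"
        using M[of p] by (simp add: mult_left_mono)
    qed auto
    also have "\<dots> = (c N - chebyshev_theta N / real N) * M"
      by (simp add: c_def chebyshev_theta_eq prime_count_def sum_subtractf flip: sum_distrib_right)
         (simp add: diff_divide_distrib left_diff_distrib)
    finally have 1: "norm (c N *\<^sub>R ?A - log_prime_average T x N) \<le> (c N - chebyshev_theta N / real N) * M" .
    have "norm ?A \<le> M" unfolding prime_average_def by (intro norm_average_le M)
    then have 2: "norm ((1 - c N) *\<^sub>R ?A) \<le> \<bar>1 - c N\<bar> * M" by (simp add: mult_left_mono)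
    have "?A - log_prime_average T x N = (1 - c N) *\<^sub>R ?A + (c N *\<^sub>R ?A - log_prime_average T x N)"
      by (simp add: scaleR_left_diff_distrib)
    then show ?thesis using norm_triangle_le[OF add_mono[OF 2 1]] by (simp only:)
  qed
  moreover have "(\<lambda>N. \<bar>1 - c N\<bar> * M + (c N - chebyshev_theta N / real N) * M) \<longlonglongrightarrow> \<bar>1 - 1\<bar> * M + (1 - 1) * M"
    by (intro tendsto_intros c chebyshev_theta_asymptotics)
  ultimately show ?thesis
    by (intro Lim_null_comparison[of "\<lambda>N. prime_average T x (prime_count N) - log_prime_average T x N"] always_eventually) auto
qed

lemma filterlim_prime_count: "filterlim prime_count at_top sequentially"
  unfolding filterlim_at_top
proof
  fix n
  show "\<forall>\<^sub>F N in sequentially. n \<le> prime_count N"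
    using eventually_ge_at_top[of "nth_prime (Suc n)"]
  proof eventually_elim
    case (elim N)
    have "prime_count (nth_prime (Suc n)) \<le> prime_count N"
      unfolding prime_count_def using elim by (intro card_mono finite_primes_le) auto
    then show ?case by (simp add: prime_count_nth_prime)
  qed
qed

lemma filterlim_nth_prime: "filterlim nth_prime at_top sequentially"
proof -
  \<comment> \<open>Shifted by one, because \<open>nth_prime\<close> takes the same value at 0 and
    at 1.\<close>
  have "strict_mono (\<lambda>n. nth_prime (Suc n))"
    by (simp add: strict_mono_def nth_prime_less_iff)
  from filterlim_subseq[OF this] show ?thesis
    by (simp add: filterlim_sequentially_Suc)
qed

text \<open>\<open>prime_count\<close> tends to infinity, and \<open>nth_prime\<close> is a right
  inverse of it from index 1 on, so a limit passes in both directions.\<close>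

lemma tendsto_prime_count_iff:
  fixes u :: "nat \<Rightarrow> 'a::topological_space"
  shows "(\<lambda>N. u (prime_count N)) \<longlonglongrightarrow> L \<longleftrightarrow> u \<longlonglongrightarrow> L"
proof
  assume "(\<lambda>N. u (prime_count N)) \<longlonglongrightarrow> L"
  from filterlim_compose[OF this filterlim_nth_prime]
  have "(\<lambda>n. u (prime_count (nth_prime n))) \<longlonglongrightarrow> L" .
  moreover have "\<forall>\<^sub>F n in sequentially. u (prime_count (nth_prime n)) = u n"
    using eventually_ge_at_top[of 1] by eventually_elim (simp add: prime_count_nth_prime)
  ultimately show "u \<longlonglongrightarrow> L" by (rule Lim_transform_eventually)
next
  assume "u \<longlonglongrightarrow> L"
  from filterlim_compose[OF this filterlim_prime_count]
  show "(\<lambda>N. u (prime_count N)) \<longlonglongrightarrow> L" .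
qed

theorem proposition4p2:
  fixes T :: "'a::banach \<Rightarrow> 'a" and x :: 'a
  assumes "power_bounded T"
  shows "(\<forall>N. log_prime_average T x N = weighted_average mangoldt' T x N) \<and>
    (convergent (prime_average T x) \<longleftrightarrow> convergent (log_prime_average T x)) \<and>
    (convergent (log_prime_average T x) \<longleftrightarrow> convergent (weighted_average mangoldt T x)) \<and>
    (convergent (prime_average T x) \<or> convergent (log_prime_average T x) \<or>
        convergent (weighted_average mangoldt T x) \<longrightarrow>
      lim (prime_average T x) = lim (log_prime_average T x) \<and>
      lim (log_prime_average T x) = lim (weighted_average mangoldt T x))"
proof -
  \<comment> \<open>Stated for each candidate limit L, so that equivalence of convergence and
    equality of the limits follow together.\<close>
  have 1: "prime_average T x \<longlonglongrightarrow> L \<longleftrightarrow> log_prime_average T x \<longlonglongrightarrow> L" for L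
    using Lim_transform_eq[OF prime_averages_diff[OF assms, of x]] tendsto_prime_count_iff[of "prime_average T x"]
    by simp
  have log_prime_average_fun: "log_prime_average T x = weighted_average mangoldt' T x"
    by (rule ext) (rule log_prime_average_eq)
  have 2: "weighted_average mangoldt T x \<longlonglongrightarrow> L \<longleftrightarrow> log_prime_average T x \<longlonglongrightarrow> L" for L
    using Lim_transform_eq[OF mangoldt_averages_diff[OF assms, of x]]
    by (simp add: log_prime_average_fun)
  have "lim (prime_average T x) = lim (log_prime_average T x)"
    "lim (weighted_average mangoldt T x) = lim (log_prime_average T x)"
    by (simp_all add: lim_def 1 2)
  then show ?thesis by (simp add: log_prime_average_eq[symmetric] convergent_def 1 2)
qed

end
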